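(* Let $G$ be a countable group and $H_1\supseteq H_2\supseteq\cdots$ a decreasing sequence of finite-index normal subgroups of $G$ with $\bigcap_nH_n=\{e\}$. Let $\{a_n\}_{n=1}^\infty$ be a sequence of positive numbers satisfying $a_n<a_{n-1}[H_{n-1}:H_n]$ (for all $n\ge2$), such that the limit $\lim_{n\to\infty}\frac{a_n}{[G:H_n]}=\theta$ exists and satisfies $\theta<1$. Then for every integer $k>1$ there exists a Toeplitz element $x\in\{1,\dots,k\}^G$ (with respect to $\{H_n\}_{n\in\mathbb N}$) such that $$h_\Sigma(\overline{Gx},G)=\lim_{n\to\infty}\frac{a_n}{[G:H_n]}\log k=\lim_{n\to\infty}\frac{\#\mathrm{Per}_{H_n}(x,* )}{[G:H_n]}\log k,$$ where $\Sigma=\{\sigma_n\colon G\to\mathrm{Sym}(G/H_n)\}_{n\in\mathbb N}$ is the sofic approximation given by the natural action on cosets, $\sigma_n(g)(cH_n)=cg^{-1}H_n$, and $\#\mathrm{Per}_{H_n}(x,* )=a_n$ for every $n\in\mathbb N$.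
   Context: $\mathbb N=\{1,2,\dots\}$; $e$ is the neutral element of $G$; $\mathrm{Sym}(V)$ is the group of bijections of a set $V$; $\overline{Gx}$ is the orbit closure of $x$. "Decreasing" for a sequence of subgroups means $H_{n+1}\subseteq H_n$ for all $n$ (not necessarily strictly). Sofic approximation: a sequence $\Sigma=\{\sigma_n\colon G\to\mathrm{Sym}(V_n)\}_{n\in\mathbb N}$ of maps, with $V_n$ finite sets, $\sigma_{n,s}:=\sigma_n(s)$, such that (S1) $|\{v\in V_n:\sigma_{n,st}(v)=\sigma_{n,s}\sigma_{n,t}(v)\}|/|V_n|\to1$ for all $s,t\in G$, and (S2) $|\{v\in V_n:\sigma_{n,s}(v)\ne\sigma_{n,t}(v)\}|/|V_n|\to1$ for all distinct $s,t\in G$. Sofic topological entropy: let $G$ act continuously on a compact metrizable space $X$, and let $d\le 1$ be a continuous pseudometric on $X$ that is dynamically generating (for distinct $x,y\in X$ there is $s\in G$ with $d(sx,sy)>0$). For maps $\varphi,\psi\colon V\to X$ from a finite set put $d_2(\varphi,\psi)=\big(\frac1{|V|}\sum_{v\in V}d(\varphi(v),\psi(v))^2\big)^{1/2}$ and $d_\infty(\varphi,\psi)=\max_{v\in V}d(\varphi(v),\psi(v))$. For finite $F\subset G$, $\delta>0$ and $\sigma\colon G\to\mathrm{Sym}(V)$, $\mathrm{Map}(d,F,\delta,\sigma)$ is the set of $\varphi\colon V\to X$ with $d_2(\varphi\sigma_s,s\varphi)\le\delta$ for all $s\in F$, where $(s\varphi)(v)=s(\varphi(v))$. $N_\epsilon(Y,\rho)$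 is the maximal cardinality of a subset of $Y$ whose distinct points are at $\rho$-distance $>\epsilon$. Then $$h_\Sigma(X,G)=\sup_{\epsilon>0}\inf_{F\subset G\text{ finite}}\inf_{\delta>0}\limsup_{n\to\infty}\frac1{|V_n|}\log N_\epsilon(\mathrm{Map}(d,F,\delta,\sigma_n),d_\infty),$$ with $\log0=-\infty$; this value does not depend on the choice of $d$. Shift: $\{1,\dots,k\}^G$ has the product topology and the action $(gx)_h=x_{g^{-1}h}$. Toeplitz elements: for a normal subgroup $H$ of $G$ and $x\in\{1,\dots,k\}^G$, $\mathrm{Per}_H(x)=\{g\in G: x_{h^{-1}g}=x_g\text{ for all }h\in H\}$ (the union of the cosets of $H$ on which $x$ is constant). $\#\mathrm{Per}_H(x,* )$ is the number of cosets of $H$ on which $x$ is not constant (the $H$-holes). $x$ is a Toeplitz element with respect to a decreasing sequence $\{H_n\}$ of finite-index subgroups if $G=\bigcup_n\mathrm{Per}_{H_n}(x)$.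
   Formalization: The subgroups are assumed strictly decreasing, a_1 ≤ [G:H_1] is assumed, and the a_n are integers; each is forced by #Per_{H_n}(x,* ) = a_n, and without them the claim is false (e.g. G = Z, H_n = 2^n Z, a_1 = 3, a_n = 1 for n ≥ 2). *)

theory Defs
  imports "HOL-Analysis.Analysis" "HOL-Algebra.Group_Action"
begin

section \<open>Sofic approximations\<close>

text \<open>Sequences are indexed by the positive integers, so index 0 is never constrained.\<close>

definition sofic_approximation ::
    "('g, 'b) monoid_scheme \<Rightarrow> (nat \<Rightarrow> 'v set) \<Rightarrow> (nat \<Rightarrow> 'g \<Rightarrow> 'v \<Rightarrow> 'v) \<Rightarrow> bool" where
  "sofic_approximation G V \<sigma> \<longleftrightarrow>
     (\<forall>n\<ge>1. finite (V n) \<and> \<sigma> n \<in> carrier G \<rightarrow> Bij (V n)) \<and>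
     (\<forall>s\<in>carrier G. \<forall>t\<in>carrier G.
        (\<lambda>n. real (card {v \<in> V n. \<sigma> n (s \<otimes>\<^bsub>G\<^esub> t) v = \<sigma> n s (\<sigma> n t v)}) / real (card (V n)))
          \<longlonglongrightarrow> 1) \<and>
     (\<forall>s\<in>carrier G. \<forall>t\<in>carrier G. s \<noteq> t \<longrightarrow>
        (\<lambda>n. real (card {v \<in> V n. \<sigma> n s v \<noteq> \<sigma> n t v}) / real (card (V n))) \<longlonglongrightarrow> 1)"

section \<open>Sofic topological entropy\<close>

text \<open>A space is an abstract topology \<open>X\<close>; an action is given by \<open>act g x\<close>, for \<open>g\<close> in the
  carrier of \<open>G\<close> and \<open>x\<close> in \<open>topspace X\<close>.\<close>

definition generating_pseudometric ::
    "('g, 'b) monoid_scheme \<Rightarrow> 'x topology \<Rightarrow> ('g \<Rightarrow> 'x \<Rightarrow> 'x) \<Rightarrow> ('x \<Rightarrow> 'x \<Rightarrow> real) \<Rightarrow> bool" where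
  "generating_pseudometric G X act d \<longleftrightarrow>
     (\<forall>x\<in>topspace X. d x x = 0) \<and>
     (\<forall>x\<in>topspace X. \<forall>y\<in>topspace X. 0 \<le> d x y \<and> d x y \<le> 1 \<and> d x y = d y x) \<and>
     (\<forall>x\<in>topspace X. \<forall>y\<in>topspace X. \<forall>z\<in>topspace X. d x z \<le> d x y + d y z) \<and>
     continuous_map (prod_topology X X) euclideanreal (\<lambda>(x, y). d x y) \<and>
     (\<forall>x\<in>topspace X. \<forall>y\<in>topspace X. x \<noteq> y \<longrightarrow> (\<exists>s\<in>carrier G. d (act s x) (act s y) > 0))"

definition dist2 :: "('x \<Rightarrow> 'x \<Rightarrow> real) \<Rightarrow> 'v set \<Rightarrow> ('v \<Rightarrow> 'x) \<Rightarrow> ('v \<Rightarrow> 'x) \<Rightarrow> real" where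
  "dist2 d V \<phi> \<psi> = sqrt ((\<Sum>v\<in>V. (d (\<phi> v) (\<psi> v))\<^sup>2) / real (card V))"

definition dist_inf :: "('x \<Rightarrow> 'x \<Rightarrow> real) \<Rightarrow> 'v set \<Rightarrow> ('v \<Rightarrow> 'x) \<Rightarrow> ('v \<Rightarrow> 'x) \<Rightarrow> real" where
  "dist_inf d V \<phi> \<psi> = Max ((\<lambda>v. d (\<phi> v) (\<psi> v)) ` V)"

definition Map_space ::
    "'x topology \<Rightarrow> ('g \<Rightarrow> 'x \<Rightarrow> 'x) \<Rightarrow> ('x \<Rightarrow> 'x \<Rightarrow> real) \<Rightarrow> 'g set \<Rightarrow> real \<Rightarrow>
     'v set \<Rightarrow> ('g \<Rightarrow> 'v \<Rightarrow> 'v) \<Rightarrow> ('v \<Rightarrow> 'x) set" where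
  "Map_space X act d F \<delta> V \<sigma> =
     {\<phi> \<in> V \<rightarrow>\<^sub>E topspace X.
        \<forall>s\<in>F. dist2 d V (\<lambda>v. \<phi> (\<sigma> s v)) (\<lambda>v. act s (\<phi> v)) \<le> \<delta>}"

text \<open>Maximal cardinality of an \<open>\<epsilon>\<close>-separated subset, \<open>\<infinity>\<close> if there is no bound
  (which does not happen for compact spaces).\<close>

definition sep_number :: "real \<Rightarrow> 'a set \<Rightarrow> ('a \<Rightarrow> 'a \<Rightarrow> real) \<Rightarrow> enat" where
  "sep_number \<epsilon> Y \<rho> =
     (SUP A \<in> {A. A \<subseteq> Y \<and> finite A \<and> (\<forall>a\<in>A. \<forall>b\<in>A. a \<noteq> b \<longrightarrow> \<rho> a b > \<epsilon>)}. enat (card A))"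

definition log_card :: "enat \<Rightarrow> ereal" where
  "log_card N = (case N of enat m \<Rightarrow> (if m = 0 then - \<infinity> else ereal (ln (real m))) | \<infinity> \<Rightarrow> \<infinity>)"

definition sofic_entropy_wrt ::
    "('g, 'b) monoid_scheme \<Rightarrow> (nat \<Rightarrow> 'v set) \<Rightarrow> (nat \<Rightarrow> 'g \<Rightarrow> 'v \<Rightarrow> 'v) \<Rightarrow>
     'x topology \<Rightarrow> ('g \<Rightarrow> 'x \<Rightarrow> 'x) \<Rightarrow> ('x \<Rightarrow> 'x \<Rightarrow> real) \<Rightarrow> ereal" where
  "sofic_entropy_wrt G V \<sigma> X act d =
     (SUP \<epsilon> \<in> {0<..}. INF F \<in> {F. F \<subseteq> carrier G \<and> finite F}. INF \<delta> \<in> {0<..}.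
        limsup (\<lambda>n. ereal (1 / real (card (V n))) *
          log_card (sep_number \<epsilon> (Map_space X act d F \<delta> (V n) (\<sigma> n)) (dist_inf d (V n)))))"

text \<open>The sofic entropy is the common value over all continuous dynamically generating
  pseudometrics bounded by 1. It is meant for continuous actions on compact metrizable spaces,
  where such pseudometrics exist and the value is independent of the choice.\<close>

definition sofic_entropy ::
    "('g, 'b) monoid_scheme \<Rightarrow> (nat \<Rightarrow> 'v set) \<Rightarrow> (nat \<Rightarrow> 'g \<Rightarrow> 'v \<Rightarrow> 'v) \<Rightarrow>
     'x topology \<Rightarrow> ('g \<Rightarrow> 'x \<Rightarrow> 'x) \<Rightarrow> ereal" where
  "sofic_entropy G V \<sigma> X act =
     (THE h. \<forall>d. generating_pseudometric G X act d \<longrightarrow> sofic_entropy_wrt G V \<sigma> X act d = h)"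

section \<open>The full shift\<close>

definition full_shift :: "('g, 'b) monoid_scheme \<Rightarrow> nat \<Rightarrow> ('g \<Rightarrow> nat) topology" where
  "full_shift G k = product_topology (\<lambda>_. discrete_topology {1..k}) (carrier G)"

definition shift :: "('g, 'b) monoid_scheme \<Rightarrow> 'g \<Rightarrow> ('g \<Rightarrow> 'a) \<Rightarrow> ('g \<Rightarrow> 'a)" where
  "shift G g x = (\<lambda>h\<in>carrier G. x (inv\<^bsub>G\<^esub> g \<otimes>\<^bsub>G\<^esub> h))"

definition orbit_closure :: "('g, 'b) monoid_scheme \<Rightarrow> nat \<Rightarrow> ('g \<Rightarrow> nat) \<Rightarrow> ('g \<Rightarrow> nat) topology" where
  "orbit_closure G k x =
     subtopology (full_shift G k) ((full_shift G k) closure_of (orbit G (shift G) x))"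

section \<open>Cosets and Toeplitz elements\<close>

text \<open>Only used for normal subgroups, where left and right cosets coincide.\<close>

definition subgroup_index :: "('g, 'b) monoid_scheme \<Rightarrow> 'g set \<Rightarrow> nat" where
  "subgroup_index G H = card (rcosets\<^bsub>G\<^esub> H)"

definition coset_action :: "('g, 'b) monoid_scheme \<Rightarrow> 'g set \<Rightarrow> 'g \<Rightarrow> 'g set \<Rightarrow> 'g set" where
  "coset_action G H g = (\<lambda>C \<in> rcosets\<^bsub>G\<^esub> H. C <#>\<^bsub>G\<^esub> (inv\<^bsub>G\<^esub> g <#\<^bsub>G\<^esub> H))"
  \<comment> \<open>the product of the cosets \<open>cH\<close> and \<open>g\<inverse>H\<close> is \<open>cg\<inverse>H\<close>\<close>

definition Per :: "('g, 'b) monoid_scheme \<Rightarrow> 'g set \<Rightarrow> ('g \<Rightarrow> 'a) \<Rightarrow> 'g set" where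
  "Per G H x = {g \<in> carrier G. \<forall>h\<in>H. x (inv\<^bsub>G\<^esub> h \<otimes>\<^bsub>G\<^esub> g) = x g}"

definition num_holes :: "('g, 'b) monoid_scheme \<Rightarrow> 'g set \<Rightarrow> ('g \<Rightarrow> 'a) \<Rightarrow> nat" where
  "num_holes G H x = card {C \<in> rcosets\<^bsub>G\<^esub> H. \<not> x constant_on C}"

definition toeplitz :: "('g, 'b) monoid_scheme \<Rightarrow> (nat \<Rightarrow> 'g set) \<Rightarrow> ('g \<Rightarrow> 'a) \<Rightarrow> bool" where
  "toeplitz G H x \<longleftrightarrow> carrier G = (\<Union>n\<in>{1..}. Per G (H n) x)"

end

theory Submission
  imports Defs "HOL-Real_Asymp.Real_Asymp"
begin

text \<open>
  Write \<open>N\<^sub>n = [G : H\<^sub>n]\<close>. The element \<open>x\<close> is found in two steps that do not interfere.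

  \<^emph>\<open>Where the holes are.\<close> There are nested sets \<open>D\<^sub>n\<close> with empty intersection, \<open>D\<^sub>n\<close> being a union of
  exactly \<open>a\<^sub>n\<close> cosets of \<open>H\<^sub>n\<close>: since \<open>a\<^sub>n\<^sub>+\<^sub>1 < a\<^sub>n [H\<^sub>n : H\<^sub>n\<^sub>+\<^sub>1]\<close>, passing from \<open>D\<^sub>n\<close> to \<open>D\<^sub>n\<^sub>+\<^sub>1\<close> discards at
  least one coset of \<open>H\<^sub>n\<^sub>+\<^sub>1\<close>, and one discarded coset can be the one containing the next element of
  an enumeration of \<open>G\<close> (\<open>hole_system_exists\<close>). The discarded cosets, called cells here, partition
  \<open>G\<close>. Any function that is constant on cells is a Toeplitz element whose \<open>H\<^sub>n\<close>-holes lie among the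
  \<open>a\<^sub>n\<close> cosets that make up \<open>D\<^sub>n\<close>.

  \<^emph>\<open>Which symbols the cells get.\<close> A function on the cells is free to satisfy countably many finite
  requirements, provided that each can be moved to cells not used before. The requirement
  ``a given pattern on positions that lie in different holes of level \<open>n\<close> occurs in \<open>x\<close> at some
  translate by \<open>H\<^sub>n\<close>'' has this property whenever the positions can be moved into \<open>D\<^sub>M\<close> for
  every \<open>M\<close>: different holes contain different cells, and cells inside \<open>D\<^sub>M\<close> with \<open>M\<close> large are new
  (\<open>reservations_exist\<close>). A rule for the remaining cells makes \<open>x\<close> non-constant on every hole, so
  that there are exactly \<open>a\<^sub>n\<close> of them (\<open>toeplitz_filling_exists\<close>).

  \<^emph>\<open>The entropy is at most \<open>\<theta> log k\<close>.\<close> If \<open>T\<close> is a transversal of \<open>H\<^sub>M\<close> and \<open>n \<ge> M\<close>, then \<open>G/H\<^sub>n\<close> is tiled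
  exactly by \<open>N\<^sub>n/N\<^sub>M\<close> copies of \<open>T\<close>. An approximately equivariant map \<open>\<phi>\<close> from \<open>G/H\<^sub>n\<close> to the orbit
  closure is essentially determined by its symbols \<open>\<phi>(v)(e)\<close>, and on all but few tiles these
  form a pattern of the orbit closure on \<open>T\<close>. There are at most \<open>N\<^sub>M k^a\<^sub>M\<close> such patterns
  (\<open>pattern_count\<close>). So the growth rate is at most \<open>(log N\<^sub>M)/N\<^sub>M + (a\<^sub>M/N\<^sub>M) log k\<close> up to an arbitrarily
  small error, and \<open>M\<close> tends to infinity.

  \<^emph>\<open>The entropy is at least \<open>\<theta> log k\<close>.\<close> Fill the holes of level \<open>n\<close> in \<open>G/H\<^sub>n\<close> in an arbitrary way and look
  at the result through a fixed finite window. As \<open>a\<^sub>n/N\<^sub>n\<close> converges, all deeper levels together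
  remove only \<open>o(N\<^sub>n)\<close> from \<open>D\<^sub>n\<close>, measured in cosets of \<open>H\<^sub>n\<close>. So at all but \<open>o(N\<^sub>n)\<close> vertices the
  holes in the window can be moved into every \<open>D\<^sub>M\<close> simultaneously (\<open>card_blocked_windows\<close>), and the
  pattern in the window is one of those that \<open>x\<close> was made to contain (\<open>window_realized\<close>).
  Sending a vertex to the corresponding translate of \<open>x\<close> is an approximately equivariant map, and
  the \<open>k\<close> to the power \<open>a\<^sub>n - o(N\<^sub>n)\<close> different fillings give uniformly separated maps
  (\<open>many_separated_models\<close>).

  Both bounds hold for every continuous generating pseudometric, because compactness translates
  distances into agreement on finite windows and back (\<open>close_if_agree\<close>, \<open>separated_if_differ\<close>).
\<close>

section \<open>Chains of finite-index normal subgroups\<close>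

locale residual_chain = group G for G (structure) +
  fixes K :: "nat \<Rightarrow> 'a set"
  assumes countable_carrier: "countable (carrier G)"
    and normal_K: "K n \<lhd> G"
    and finite_rcosets: "finite (rcosets (K n))"
    and strict_step: "K (Suc n) \<subset> K n"
    and Inter_K: "(\<Inter>n. K n) = {\<one>}"
begin

lemma subgroup_K: "subgroup (K n) G"
  using normal_K normal_imp_subgroup by blast

lemma K_carrier: "K n \<subseteq> carrier G"
  using subgroup_K subgroup.subset by blast

lemma K_mem_carrier [simp]: "h \<in> K n \<Longrightarrow> h \<in> carrier G"
  using K_carrier by blast

lemma one_in_K [simp]: "\<one> \<in> K n"
  using subgroup_K subgroup.one_closed by blast

lemma K_antimono: "m \<le> n \<Longrightarrow> K n \<subseteq> K m"
  by (rule lift_Suc_antimono_le[of K]) (use strict_step in auto)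

lemma coset_carrier: "C \<in> rcosets (K n) \<Longrightarrow> C \<subseteq> carrier G"
  using subgroup.rcosets_carrier[OF subgroup_K is_group] by blast

lemma coset_mem_carrier: "C \<in> rcosets (K n) \<Longrightarrow> u \<in> C \<Longrightarrow> u \<in> carrier G"
  using coset_carrier by blast

lemma mem_coset_carrier: "u \<in> K n #> g \<Longrightarrow> g \<in> carrier G \<Longrightarrow> u \<in> carrier G"
  using r_coset_subset_G[OF K_carrier] by blast

lemma cosetI: "g \<in> carrier G \<Longrightarrow> K n #> g \<in> rcosets (K n)"
  using rcosetsI[OF K_carrier] .

lemma coset_self: "g \<in> carrier G \<Longrightarrow> g \<in> K n #> g"
  using rcos_self[OF _ subgroup_K] .

lemma coset_eq: "g \<in> carrier G \<Longrightarrow> u \<in> K n #> g \<Longrightarrow> K n #> u = K n #> g"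
  using repr_independence[OF _ _ subgroup_K] by blast

lemma coset_eq_iff:
  "g \<in> carrier G \<Longrightarrow> u \<in> carrier G \<Longrightarrow> K n #> u = K n #> g \<longleftrightarrow> u \<in> K n #> g"
  using coset_eq coset_self by metis

lemma coset_rep: "C \<in> rcosets (K n) \<Longrightarrow> u \<in> C \<Longrightarrow> C = K n #> u"
  by (auto simp: RCOSETS_def coset_eq)

lemma coset_nonempty: "C \<in> rcosets (K n) \<Longrightarrow> \<exists>u. u \<in> C"
  using subgroup.rcosets_non_empty[OF subgroup_K] is_group by blast

lemma coset_exists_rep: "C \<in> rcosets (K n) \<Longrightarrow> \<exists>g\<in>carrier G. C = K n #> g"
  by (auto simp: RCOSETS_def)

lemma coset_antimono: "m \<le> n \<Longrightarrow> K n #> g \<subseteq> K m #> g"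
  using K_antimono by (fastforce simp: r_coset_def)

lemma coset_left_mult: "h \<in> K n \<Longrightarrow> g \<in> carrier G \<Longrightarrow> h \<otimes> g \<in> K n #> g"
  by (auto simp: r_coset_def)

lemma mem_cosetE:
  assumes "u \<in> K n #> g"
  obtains h where "h \<in> K n" "u = h \<otimes> g"
  using assms by (auto simp: r_coset_def)

lemma coset_mult: "g \<in> carrier G \<Longrightarrow> f \<in> carrier G \<Longrightarrow> (K n #> g) #> f = K n #> (g \<otimes> f)"
  using coset_mult_assoc[OF K_carrier] .

lemma coset_mult_mem: "C \<in> rcosets (K n) \<Longrightarrow> f \<in> carrier G \<Longrightarrow> C #> f \<in> rcosets (K n)"
  using coset_exists_rep coset_mult cosetI by (metis m_closed)

lemma coset_mult_rep: "C \<in> rcosets (K n) \<Longrightarrow> u \<in> C \<Longrightarrow> f \<in> carrier G \<Longrightarrow> C #> f = K n #> (u \<otimes> f)"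
  using coset_rep coset_mult coset_mem_carrier by metis

lemma coset_mult_mult:
  "C \<in> rcosets (K n) \<Longrightarrow> s \<in> carrier G \<Longrightarrow> t \<in> carrier G \<Longrightarrow> (C #> s) #> t = C #> (s \<otimes> t)"
  using coset_mult_assoc[OF coset_carrier] .

lemma rcoset_mult_one: "C \<in> rcosets (K n) \<Longrightarrow> C #> \<one> = C"
  using coset_mult_one coset_carrier by blast

lemma K_coset: "K n \<in> rcosets (K n)"
  using cosetI[OF one_closed, of n] coset_mult_one[OF K_carrier] by simp

lemma coset_mult_inj: "s \<in> carrier G \<Longrightarrow> inj_on (\<lambda>C. C #> s) (rcosets (K n))"
  by (rule inj_on_inverseI[of _ "\<lambda>C. C #> inv s"]) (simp add: coset_mult_mult rcoset_mult_one)

text \<open>By normality, whether two translates of a coset coincide does not depend on the coset.\<close>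

lemma coset_mult_eq_iff:
  assumes "C \<in> rcosets (K n)" "f \<in> carrier G" "f' \<in> carrier G"
  shows "C #> f = C #> f' \<longleftrightarrow> f \<otimes> inv f' \<in> K n"
proof -
  obtain g where g: "g \<in> carrier G" "C = K n #> g"
    using assms(1) coset_exists_rep by blast
  have "C #> f = C #> f' \<longleftrightarrow> K n #> (g \<otimes> f) = K n #> (g \<otimes> f')"
    using g assms by (simp add: coset_mult)
  also have "\<dots> \<longleftrightarrow> (g \<otimes> f) \<otimes> inv (g \<otimes> f') \<in> K n"
    using coset_eq_iff subgroup.rcos_module[OF subgroup_K is_group] g assms by simp
  also have "(g \<otimes> f) \<otimes> inv (g \<otimes> f') = g \<otimes> (f \<otimes> inv f') \<otimes> inv g"
    using g assms by (simp add: inv_mult_group m_assoc)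
  also have "\<dots> \<in> K n \<longleftrightarrow> f \<otimes> inv f' \<in> K n"
  proof
    assume *: "g \<otimes> (f \<otimes> inv f') \<otimes> inv g \<in> K n"
    have "inv g \<otimes> (g \<otimes> (f \<otimes> inv f') \<otimes> inv g) \<otimes> g \<in> K n"
      using normal.inv_op_closed1[OF normal_K g(1) *] .
    also have "inv g \<otimes> (g \<otimes> (f \<otimes> inv f') \<otimes> inv g) \<otimes> g = f \<otimes> inv f'"
      using g assms by (simp add: m_assoc inv_solve_left')
    finally show "f \<otimes> inv f' \<in> K n" .
  qed (use normal.inv_op_closed2[OF normal_K g(1)] in blast)
  finally show ?thesis .
qed

lemma eventually_notin_K:
  assumes "g \<in> carrier G" "g \<noteq> \<one>"
  shows "\<forall>\<^sub>F n in sequentially. g \<notin> K n"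
proof -
  have "g \<notin> (\<Inter>n. K n)" using Inter_K assms by simp
  then obtain n where "g \<notin> K n" by blast
  then show ?thesis
    using K_antimono eventually_sequentially by blast
qed

text \<open>This is where the trivial intersection of the chain enters: each of the finitely many quotients
  of different elements of the window leaves the chain at some point.\<close>

lemma eventually_window_inj:
  assumes "finite W" "W \<subseteq> carrier G"
  shows "\<forall>\<^sub>F n in sequentially. \<forall>C\<in>rcosets (K n). inj_on (\<lambda>f. C #> f) W"
proof -
  have "\<forall>\<^sub>F n in sequentially. \<forall>f\<in>W. \<forall>f'\<in>W. f \<noteq> f' \<longrightarrow> f \<otimes> inv f' \<notin> K n"
  proof (intro eventually_ball_finite assms ballI)
    fix f f' assume f: "f \<in> W" "f' \<in> W"
    show "\<forall>\<^sub>F n in sequentially. f \<noteq> f' \<longrightarrow> f \<otimes> inv f' \<notin> K n"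
    proof (cases "f = f'")
      case False
      have "f \<otimes> inv f' \<noteq> \<one>"
        using f assms False by (metis inv_closed inv_equality inv_inv subsetD)
      then have "\<forall>\<^sub>F n in sequentially. f \<otimes> inv f' \<notin> K n"
        using f assms by (intro eventually_notin_K) auto
      then show ?thesis by eventually_elim simp
    qed simp
  qed
  then show ?thesis
  proof eventually_elim
    case (elim n)
    show ?case
    proof (intro ballI inj_onI)
      fix C f f' assume "C \<in> rcosets (K n)" "f \<in> W" "f' \<in> W" "C #> f = C #> f'"
      then show "f = f'"
        using elim assms(2) coset_mult_eq_iff[of C n f f'] by blast
    qed
  qed
qed

section \<open>Counting cosets along the chain\<close>

abbreviation index :: "nat \<Rightarrow> nat" where
  "index n \<equiv> subgroup_index G (K n)"

definition subcosets :: "nat \<Rightarrow> 'a set \<Rightarrow> 'a set set" where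
  "subcosets m A = {C \<in> rcosets (K m). C \<subseteq> A}"

abbreviation ratio :: "nat \<Rightarrow> nat \<Rightarrow> nat" where
  "ratio n m \<equiv> card (subcosets m (K n))"

lemma finite_subcosets [simp]: "finite (subcosets m A)"
  using finite_rcosets by (auto simp: subcosets_def)

lemma index_pos: "index n > 0"
  unfolding subgroup_index_def using cosetI[OF one_closed] finite_rcosets
  by (metis card_gt_0_iff empty_iff)

lemma card_subcosets_coset:
  assumes "n \<le> m" "C \<in> rcosets (K n)"
  shows "card (subcosets m C) = ratio n m"
proof -
  obtain g where g: "g \<in> carrier G" "C = K n #> g"
    using assms coset_exists_rep by blast
  have "bij_betw (\<lambda>B. B #> g) (subcosets m (K n)) (subcosets m C)"
  proof (rule bij_betwI[of _ _ _ "\<lambda>B. B #> inv g"])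
    show "(\<lambda>B. B #> g) \<in> subcosets m (K n) \<rightarrow> subcosets m C"
      using g coset_mult_mem by (fastforce simp: subcosets_def r_coset_def)
    show "(\<lambda>B. B #> inv g) \<in> subcosets m C \<rightarrow> subcosets m (K n)"
    proof
      fix B assume B: "B \<in> subcosets m C"
      then have "B #> inv g \<subseteq> (K n #> g) #> inv g"
        using g by (auto simp: subcosets_def r_coset_def)
      also have "\<dots> = K n" using g coset_mult K_carrier by simp
      finally show "B #> inv g \<in> subcosets m (K n)"
        using B g coset_mult_mem by (simp add: subcosets_def)
    qed
  qed (auto simp: subcosets_def coset_mult_mult rcoset_mult_one g)
  then show ?thesis by (metis bij_betw_same_card)
qed

lemma coset_refine:
  assumes "n \<le> m" "C \<in> rcosets (K n)" "u \<in> C"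
  shows "K m #> u \<in> subcosets m C"
  using assms coset_antimono coset_rep cosetI coset_mem_carrier unfolding subcosets_def by blast

lemma rcosets_eq: "C \<in> rcosets (K n) \<Longrightarrow> C' \<in> rcosets (K n) \<Longrightarrow> u \<in> C \<Longrightarrow> u \<in> C' \<Longrightarrow> C = C'"
  using coset_rep by metis

lemma card_subcosets_Union:
  assumes "n \<le> m" "\<C> \<subseteq> rcosets (K n)"
  shows "card (subcosets m (\<Union>\<C>)) = card \<C> * ratio n m"
proof -
  have "subcosets m (\<Union>\<C>) = (\<Union>C\<in>\<C>. subcosets m C)"
  proof
    show "subcosets m (\<Union>\<C>) \<subseteq> (\<Union>C\<in>\<C>. subcosets m C)"
    proof
      fix B assume B: "B \<in> subcosets m (\<Union>\<C>)"
      then have "B \<in> rcosets (K m)" by (simp add: subcosets_def)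
      from coset_nonempty[OF this] obtain u where u: "u \<in> B" ..
      with B obtain C where C: "C \<in> \<C>" "u \<in> C" by (auto simp: subcosets_def)
      have "B = K m #> u" using B u coset_rep by (auto simp: subcosets_def)
      then show "B \<in> (\<Union>C\<in>\<C>. subcosets m C)"
        using coset_refine[OF assms(1) _ C(2)] C assms(2) by auto
    qed
  qed (auto simp: subcosets_def)
  also have "card \<dots> = (\<Sum>C\<in>\<C>. card (subcosets m C))"
  proof (rule card_UN_disjoint)
    show "finite \<C>" using assms(2) finite_rcosets finite_subset by blast
    show "\<forall>C\<in>\<C>. \<forall>C'\<in>\<C>. C \<noteq> C' \<longrightarrow> subcosets m C \<inter> subcosets m C' = {}"
    proof (intro ballI impI, rule ccontr)
      fix C C' assume C: "C \<in> \<C>" "C' \<in> \<C>" "C \<noteq> C'" "subcosets m C \<inter> subcosets m C' \<noteq> {}"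
      then obtain B where B: "B \<in> rcosets (K m)" "B \<subseteq> C" "B \<subseteq> C'"
        by (auto simp: subcosets_def)
      with coset_nonempty obtain u where "u \<in> B" by blast
      with B C assms(2) rcosets_eq show False by (metis subsetD)
    qed
  qed simp
  also have "\<dots> = card \<C> * ratio n m"
    using assms card_subcosets_coset by (simp add: subset_iff)
  finally show ?thesis .
qed

lemma Union_rcosets: "\<Union>(rcosets (K n)) = carrier G"
  using rcosets_part_G[OF subgroup_K] .

lemma index_mult: "n \<le> m \<Longrightarrow> index m = index n * ratio n m"
proof -
  assume "n \<le> m"
  have "subcosets m (\<Union>(rcosets (K n))) = rcosets (K m)"
    using coset_carrier by (auto simp: Union_rcosets subcosets_def)
  then show ?thesis
    using card_subcosets_Union[OF \<open>n \<le> m\<close> order_refl] by (simp add: subgroup_index_def)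
qed

lemma ratio_pos: "n \<le> m \<Longrightarrow> ratio n m > 0"
  using index_mult[of n m] index_pos[of m] by (cases "ratio n m") auto

lemma ratio_Suc_ge2: "ratio n (Suc n) \<ge> 2"
proof -
  obtain h where h: "h \<in> K n" "h \<notin> K (Suc n)" using strict_step by blast
  have "K (Suc n) \<in> subcosets (Suc n) (K n)"
    using K_coset strict_step by (auto simp: subcosets_def)
  moreover have "K (Suc n) #> h \<in> subcosets (Suc n) (K n)"
    using coset_refine[OF _ K_coset h(1)] by simp
  moreover have "K (Suc n) #> h \<noteq> K (Suc n)"
    using h coset_self[of h "Suc n"] by auto
  ultimately have "{K (Suc n), K (Suc n) #> h} \<subseteq> subcosets (Suc n) (K n)"
    "card {K (Suc n), K (Suc n) #> h} = 2" by auto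
  then show ?thesis by (metis card_mono finite_subcosets)
qed

lemma index_ge_exp: "2 ^ n \<le> index n"
proof (induction n)
  case 0
  then show ?case using index_pos[of 0] by simp
next
  case (Suc n)
  have "2 ^ Suc n \<le> index n * 2" using Suc by simp
  also have "\<dots> \<le> index n * ratio n (Suc n)" using ratio_Suc_ge2 by simp
  finally show ?case using index_mult[of n "Suc n"] by simp
qed

lemma filterlim_index: "filterlim (\<lambda>n. real (index n)) at_top sequentially"
proof (rule filterlim_at_top_mono)
  show "filterlim (\<lambda>n. 2 ^ n :: real) at_top sequentially"
    by real_asymp
  show "\<forall>\<^sub>F n in sequentially. 2 ^ n \<le> real (index n)"
    using index_ge_exp by (metis (mono_tags, lifting) always_eventually of_nat_le_iff of_nat_numeral of_nat_power)
qed

section \<open>The coset actions form a sofic approximation\<close>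

text \<open>The models act by right multiplication. So an equivariant map \<open>\<phi>\<close> into the shift satisfies
  \<open>\<phi> C f = \<phi> (C #> f) \<one>\<close> and is determined by the colouring of the vertices that takes \<open>C\<close> to
  \<open>\<phi> C \<one>\<close>. Both entropy bounds pass between maps and colourings in this way.\<close>

lemma coset_action_eq:
  assumes "C \<in> rcosets (K n)" "s \<in> carrier G"
  shows "coset_action G (K n) s C = C #> inv s"
proof -
  obtain g where g: "g \<in> carrier G" "C = K n #> g"
    using assms coset_exists_rep by blast
  have "inv s <# K n = K n #> inv s"
    using normal.coset_eq[OF normal_K] assms by simp
  then show ?thesis
    using assms g normal.rcos_sum[OF normal_K] coset_mult by (simp add: coset_action_def)
qed

lemma coset_action_mem:
  "C \<in> rcosets (K n) \<Longrightarrow> s \<in> carrier G \<Longrightarrow> coset_action G (K n) s C \<in> rcosets (K n)"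
  by (simp add: coset_action_eq coset_mult_mem)

lemma coset_action_mult:
  assumes "C \<in> rcosets (K n)" "s \<in> carrier G" "t \<in> carrier G"
  shows "coset_action G (K n) (s \<otimes> t) C = coset_action G (K n) s (coset_action G (K n) t C)"
  using assms by (simp add: coset_action_eq coset_mult_mem coset_mult_mult inv_mult_group)

lemma bij_coset_action:
  assumes "s \<in> carrier G"
  shows "bij_betw (coset_action G (K n) s) (rcosets (K n)) (rcosets (K n))"
  by (rule bij_betwI[of _ _ _ "coset_action G (K n) (inv s)"])
     (use assms in \<open>auto simp: coset_action_eq coset_mult_mem coset_mult_mult rcoset_mult_one\<close>)

lemma coset_action_Bij:
  assumes "s \<in> carrier G"
  shows "coset_action G (K n) s \<in> Bij (rcosets (K n))"
  using bij_coset_action[OF assms] by (simp add: Bij_def coset_action_def)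

lemma eventually_coset_action_neq:
  assumes "s \<in> carrier G" "t \<in> carrier G" "s \<noteq> t"
  shows "\<forall>\<^sub>F n in sequentially. \<forall>C\<in>rcosets (K n). coset_action G (K n) s C \<noteq> coset_action G (K n) t C"
proof -
  have "\<forall>\<^sub>F n in sequentially. \<forall>C\<in>rcosets (K n). inj_on (\<lambda>f. C #> f) {inv s, inv t}"
    using assms by (intro eventually_window_inj) auto
  then show ?thesis
  proof eventually_elim
    case (elim n)
    show ?case
    proof (intro ballI notI)
      fix C assume C: "C \<in> rcosets (K n)"
        "coset_action G (K n) s C = coset_action G (K n) t C"
      then have "inv s = inv t"
        using elim assms coset_action_eq[OF C(1)] by (metis inj_onD insertCI)
      then show False using assms by (metis inv_inv)
    qed
  qed
qed

end

section \<open>Nested systems of holes\<close>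

locale hole_system = residual_chain +
  fixes \<D> :: "nat \<Rightarrow> 'a set set"
  assumes holes_rcosets: "\<D> n \<subseteq> rcosets (K n)"
    and holes_decreasing: "\<Union>(\<D> (Suc n)) \<subseteq> \<Union>(\<D> n)"
    and holes_vanish: "(\<Inter>n. \<Union>(\<D> n)) = {}"

text \<open>The strict inequality leaves room to discard, at step \<open>n\<close>, the coset that contains the \<open>n\<close>-th
  element of \<open>G\<close>. This is what makes the holes vanish in the limit.\<close>

lemma (in residual_chain) hole_system_exists:
  assumes b0: "b 0 \<le> index 0" and b_Suc: "\<And>n. b (Suc n) < b n * ratio n (Suc n)"
  shows "\<exists>\<D>. hole_system G K \<D> \<and> (\<forall>n. card (\<D> n) = b n)"
proof -
  define e where "e = from_nat_into (carrier G)"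
  have range_e: "range e = carrier G"
    unfolding e_def using countable_carrier by (intro range_from_nat_into) auto
  define P where "P n \<C> \<longleftrightarrow> \<C> \<subseteq> rcosets (K n) \<and> card \<C> = b n" for n \<C>
  define Q where "Q n \<C> \<C>' \<longleftrightarrow> \<Union>\<C>' \<subseteq> \<Union>\<C> \<and> e n \<notin> \<Union>\<C>'" for n and \<C> \<C>' :: "'a set set"
  have "\<exists>f. \<forall>n. P n (f n) \<and> Q n (f n) (f (Suc n))"
  proof (rule dependent_nat_choice)
    show "\<exists>\<C>. P 0 \<C>"
      using b0 unfolding P_def subgroup_index_def by (meson obtain_subset_with_card_n)
  next
    fix \<C> n assume P: "P n \<C>"
    let ?S = "subcosets (Suc n) (\<Union>\<C>)"
    have "card ?S = b n * ratio n (Suc n)"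
      using P card_subcosets_Union[of n "Suc n" \<C>] by (simp add: P_def)
    then have "b (Suc n) < card ?S" using b_Suc by simp
    then have "b (Suc n) \<le> card (?S - {K (Suc n) #> e n})"
      using finite_subcosets[of "Suc n" "\<Union>\<C>"] by (simp add: card_Diff_singleton_if) linarith
    then obtain \<C>' where \<C>': "\<C>' \<subseteq> ?S - {K (Suc n) #> e n}" "card \<C>' = b (Suc n)"
      by (meson obtain_subset_with_card_n)
    have "e n \<notin> \<Union>\<C>'"
    proof
      assume "e n \<in> \<Union>\<C>'"
      then obtain C where "C \<in> \<C>'" "e n \<in> C" by blast
      then have "C = K (Suc n) #> e n" using \<C>'(1) coset_rep by (auto simp: subcosets_def)
      with \<open>C \<in> \<C>'\<close> \<C>'(1) show False by blast
    qed
    then show "\<exists>\<C>'. P (Suc n) \<C>' \<and> Q n \<C> \<C>'"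
      using \<C>' unfolding P_def Q_def subcosets_def by blast
  qed
  then obtain \<D> where \<D>: "\<And>n. P n (\<D> n)" "\<And>n. Q n (\<D> n) (\<D> (Suc n))" by blast
  have "g \<notin> (\<Inter>n. \<Union>(\<D> n))" for g
  proof
    assume g: "g \<in> (\<Inter>n. \<Union>(\<D> n))"
    then have "g \<in> carrier G" using \<D>(1)[of 0] coset_carrier unfolding P_def by blast
    then obtain n where "g = e n" using range_e by blast
    then show False using g \<D>(2)[of n] unfolding Q_def by blast
  qed
  then have "hole_system G K \<D>"
    using \<D> by unfold_locales (simp_all add: P_def Q_def set_eq_iff)
  then show ?thesis using \<D> by (auto simp: P_def)
qed

context hole_system
begin

abbreviation D :: "nat \<Rightarrow> 'a set" where "D n \<equiv> \<Union>(\<D> n)"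

lemma finite_holes: "finite (\<D> n)"
  using holes_rcosets finite_rcosets finite_subset by blast

lemma D_carrier: "u \<in> D n \<Longrightarrow> u \<in> carrier G"
  using holes_rcosets coset_carrier by blast

lemma D_antimono: "m \<le> n \<Longrightarrow> D n \<subseteq> D m"
  by (rule lift_Suc_antimono_le[of D]) (use holes_decreasing in auto)

lemma mem_D_iff: "u \<in> carrier G \<Longrightarrow> u \<in> D n \<longleftrightarrow> K n #> u \<in> \<D> n"
  using coset_rep coset_self holes_rcosets by (metis UnionE UnionI subsetD)

lemma mem_D_coset:
  assumes "g \<in> carrier G" "u \<in> K m #> g" "n \<le> m"
  shows "u \<in> D n \<longleftrightarrow> g \<in> D n"
proof -
  have u: "u \<in> carrier G" using assms mem_coset_carrier by blast
  have "K n #> u = K n #> g"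
    using assms coset_antimono coset_eq by blast
  then show ?thesis using mem_D_iff u assms(1) by simp
qed

text \<open>The cell of \<open>g\<close> is the coset \<open>K (level g) #> g\<close>. If \<open>level g = Suc l\<close>, the coset \<open>K l #> g\<close> around it is
  the last hole that contains \<open>g\<close>, called the parent of the cell below.\<close>

definition level :: "'a \<Rightarrow> nat" where
  "level g = (LEAST n. g \<notin> D n)"

lemma level_le_iff: "level g \<le> n \<longleftrightarrow> g \<notin> D n"
proof
  obtain m where "g \<notin> D m" using holes_vanish by blast
  then have "g \<notin> D (level g)" unfolding level_def by (rule LeastI)
  then show "level g \<le> n \<Longrightarrow> g \<notin> D n" using D_antimono by blast
  show "g \<notin> D n \<Longrightarrow> level g \<le> n" unfolding level_def by (rule Least_le)
qed

lemma less_level_iff: "n < level g \<longleftrightarrow> g \<in> D n"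
  using level_le_iff[of g n] by auto

lemma level_coset:
  assumes "g \<in> carrier G" "u \<in> K n #> g" "level g \<le> n"
  shows "level u = level g"
proof (rule order.antisym)
  show "level u \<le> level g"
    using mem_D_coset[OF assms] level_le_iff[of u "level g"] level_le_iff[of g "level g"] by simp
  show "level g \<le> level u"
  proof (cases "level u \<le> n")
    case True
    show ?thesis
      using mem_D_coset[OF assms(1,2) True] level_le_iff[of u "level u"] level_le_iff[of g "level u"]
      by simp
  qed (use assms in simp)
qed

section \<open>Reserving positions for prescribed patterns\<close>

text \<open>A request \<open>(n, ps)\<close> asks for a translate by \<open>K n\<close> of a finite pattern. The last condition says that
  its positions can be moved together into arbitrarily deep holes.\<close>

definition requests :: "nat \<Rightarrow> (nat \<times> ('a \<times> nat) list) set" where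
  "requests k = {(n, ps). set ps \<subseteq> D n \<times> {1..k} \<and>
     (\<forall>p\<in>set ps. \<forall>p'\<in>set ps. K n #> fst p = K n #> fst p' \<longrightarrow> p = p') \<and>
     (\<forall>M. \<exists>h\<in>K n. \<forall>p\<in>set ps. h \<otimes> fst p \<in> D M)}"

lemma countable_requests: "countable (requests k)"
proof (rule countable_subset)
  show "requests k \<subseteq> UNIV \<times> lists (carrier G \<times> UNIV)"
    using D_carrier by (fastforce simp: requests_def)
  show "countable ((UNIV :: nat set) \<times> lists (carrier G \<times> (UNIV :: nat set)))"
    using countable_carrier by (intro countable_SIGMA countable_lists) auto
qed

lemma finite_leaves_D:
  assumes "finite A"
  shows "\<exists>M. \<forall>u\<in>A. u \<notin> D M"
proof -
  obtain M where "\<forall>l\<in>level ` A. l \<le> M"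
    using assms by (meson finite_imageI finite_nat_set_iff_bounded_le)
  then show ?thesis using level_le_iff by blast
qed

text \<open>Requests are served one after the other, the \<open>j\<close>-th one with positions of level between \<open>M j\<close> and
  \<open>M (Suc j)\<close>. Then no two reserved positions have the same parent. For different requests the
  levels differ. Within one request the positions lie in different cosets of \<open>K n\<close>, while the
  parents are contained in such cosets because \<open>n \<le> M j\<close>. So no conflict between prescribed symbols
  can arise, and at most one child of each hole is reserved.\<close>

lemma reservations_exist:
  "\<exists>R. R \<subseteq> carrier G \<times> {1..k} \<and> (\<forall>w\<in>R. level (fst w) \<noteq> 0) \<and>
     (\<forall>w\<in>R. \<forall>w'\<in>R. \<forall>l. level (fst w) = Suc l \<longrightarrow> level (fst w') = Suc l \<longrightarrow>
        fst w' \<in> K l #> fst w \<longrightarrow> w = w') \<and>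
     (\<forall>(n, ps)\<in>requests k. \<exists>h\<in>K n. \<forall>(u, v)\<in>set ps. (h \<otimes> u, v) \<in> R)"
proof -
  define r where "r = from_nat_into (requests k)"
  have "(0, []) \<in> requests k" using one_in_K[of 0] by (auto simp: requests_def simp del: one_in_K)
  then have ne: "requests k \<noteq> {}" by blast
  then have range_r: "range r = requests k"
    unfolding r_def using countable_requests by (rule range_from_nat_into)
  have r: "r j \<in> requests k" for j using range_r by blast
  define N where "N j = fst (r j)" for j
  define ps where "ps j = set (snd (r j))" for j
  have ps: "ps j \<subseteq> D (N j) \<times> {1..k}"
    and ps_inj: "\<And>p p'. p \<in> ps j \<Longrightarrow> p' \<in> ps j \<Longrightarrow> K (N j) #> fst p = K (N j) #> fst p' \<Longrightarrow> p = p'"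
    and ps_ex: "\<And>M. \<exists>h\<in>K (N j). \<forall>p\<in>ps j. h \<otimes> fst p \<in> D M" for j
    using r[of j] unfolding requests_def N_def ps_def by (auto simp: case_prod_beta)
  define P where "P j s \<longleftrightarrow> N j \<le> snd s \<and> fst s \<in> K (N j) \<and> (\<forall>p\<in>ps j. fst s \<otimes> fst p \<in> D (snd s))"
    for j and s :: "'a \<times> nat"
  define Q where "Q j s s' \<longleftrightarrow> snd s \<le> snd s' \<and> (\<forall>p\<in>ps j. fst s \<otimes> fst p \<notin> D (snd s'))"
    for j and s s' :: "'a \<times> nat"
  have "\<exists>f. \<forall>j. P j (f j) \<and> Q j (f j) (f (Suc j))"
  proof (rule dependent_nat_choice)
    show "\<exists>s. P 0 s"
      using ps_ex[of 0 "N 0"] by (auto simp: P_def)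
  next
    fix s j assume "P j s"
    obtain M where M: "\<forall>u\<in>(\<lambda>p. fst s \<otimes> fst p) ` ps j. u \<notin> D M"
      using finite_leaves_D[of "(\<lambda>p. fst s \<otimes> fst p) ` ps j"] by (auto simp: ps_def)
    define M' where "M' = max (max M (snd s)) (N (Suc j))"
    have "M \<le> M'" by (simp add: M'_def)
    obtain h where h: "h \<in> K (N (Suc j))" "\<forall>p\<in>ps (Suc j). h \<otimes> fst p \<in> D M'"
      using ps_ex[of "Suc j" M'] by blast
    have "N (Suc j) \<le> M'" "snd s \<le> M'" by (simp_all add: M'_def)
    with h have "P (Suc j) (h, M')" by (simp add: P_def)
    moreover have "Q j s (h, M')"
      using M subsetD[OF D_antimono[OF \<open>M \<le> M'\<close>]] \<open>snd s \<le> M'\<close> unfolding Q_def by (metis image_eqI snd_conv)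
    ultimately have "P (Suc j) (h, M')" "Q j s (h, M')" .
    then show "\<exists>s'. P (Suc j) s' \<and> Q j s s'" by blast
  qed
  then obtain f where f: "\<And>j. P j (f j)" "\<And>j. Q j (f j) (f (Suc j))" by blast
  define h where "h j = fst (f j)" for j
  define M where "M j = snd (f j)" for j
  have h: "h j \<in> K (N j)" and NM: "N j \<le> M j" for j
    using f(1) by (auto simp: P_def h_def M_def)
  have in_D: "h j \<otimes> fst p \<in> D (M j)" and out_D: "h j \<otimes> fst p \<notin> D (M (Suc j))" if "p \<in> ps j" for j p
    using f(1)[of j] f(2)[of j] that by (auto simp: P_def Q_def h_def M_def)
  have M_mono: "M i \<le> M j" if "i \<le> j" for i j
    by (rule lift_Suc_mono_le[OF _ that, of M]) (use f(2) in \<open>auto simp: Q_def M_def\<close>)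
  define R where "R = (\<Union>j. (\<lambda>p. (h j \<otimes> fst p, snd p)) ` ps j)"
  have step_unique: "i = j"
    if "p \<in> ps i" "p' \<in> ps j" "level (h i \<otimes> fst p) = level (h j \<otimes> fst p')" for i j p p'
  proof -
    have *: "\<not> i < j" if "p \<in> ps i" "p' \<in> ps j" "level (h i \<otimes> fst p) = level (h j \<otimes> fst p')" for i j p p'
    proof
      assume "i < j"
      have "level (h i \<otimes> fst p) \<le> M (Suc i)" using out_D that level_le_iff by blast
      also have "\<dots> \<le> M j" using M_mono \<open>i < j\<close> by simp
      also have "\<dots> < level (h j \<otimes> fst p')" using in_D that less_level_iff by blast
      finally show False using that by simp
    qed
    show ?thesis using *[OF that] *[OF that(2,1) that(3)[symmetric]] by simp
  qed
  have R_unique: "w = w'" if "w \<in> R" "w' \<in> R" "level (fst w) = Suc l" "level (fst w') = Suc l"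
    "fst w' \<in> K l #> fst w" for w w' l
  proof -
    obtain i p where w: "p \<in> ps i" "w = (h i \<otimes> fst p, snd p)" using \<open>w \<in> R\<close> by (auto simp: R_def)
    obtain j p' where w': "p' \<in> ps j" "w' = (h j \<otimes> fst p', snd p')" using \<open>w' \<in> R\<close> by (auto simp: R_def)
    have "i = j" using step_unique[OF w(1) w'(1)] w w' that by simp
    have p: "fst p \<in> carrier G" "fst p' \<in> carrier G"
      using subsetD[OF ps w(1)] subsetD[OF ps w'(1)] D_carrier unfolding mem_Times_iff by blast+
    have hc: "h i \<otimes> fst p \<in> carrier G" using p K_mem_carrier[OF h] by simp
    have "M i < Suc l" using in_D[OF w(1)] w that less_level_iff by (metis fst_conv)
    then have "N i \<le> l" using NM[of i] by simp
    then have "fst w' \<in> K (N i) #> (h i \<otimes> fst p)"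
      using that(5) coset_antimono w by auto
    then have "K (N i) #> fst w' = K (N i) #> (h i \<otimes> fst p)" using coset_eq hc by blast
    also have "\<dots> = K (N i) #> fst p" using coset_eq[OF p(1) coset_left_mult[OF h p(1)]] .
    finally have "K (N i) #> fst p' = K (N i) #> fst p"
      using coset_eq[OF p(2) coset_left_mult[OF h p(2)], of j] w' \<open>i = j\<close> by simp
    then have "p' = p" using ps_inj w w' \<open>i = j\<close> by blast
    then show ?thesis using w w' \<open>i = j\<close> by simp
  qed
  have "level (fst w) \<noteq> 0" if w: "w \<in> R" for w
  proof -
    obtain j p where p: "p \<in> ps j" "w = (h j \<otimes> fst p, snd p)" using w by (auto simp: R_def)
    have "M j < level (fst w)" using in_D[OF p(1)] p(2) by (simp only: less_level_iff fst_conv)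
    then show ?thesis by simp
  qed
  moreover have "R \<subseteq> carrier G \<times> {1..k}"
  proof
    fix w assume "w \<in> R"
    then obtain j p where p: "p \<in> ps j" "w = (h j \<otimes> fst p, snd p)" by (auto simp: R_def)
    then show "w \<in> carrier G \<times> {1..k}"
      using D_carrier[OF in_D[OF p(1)]] subsetD[OF ps p(1)] by (simp add: mem_Times_iff)
  qed
  moreover have "\<exists>h\<in>K n. \<forall>(u, v)\<in>set qs. (h \<otimes> u, v) \<in> R" if qs: "(n, qs) \<in> requests k" for n qs
  proof -
    have "(n, qs) \<in> range r" using qs range_r by simp
    then obtain j where j: "r j = (n, qs)" by (metis rangeE)
    then have "ps j = set qs" by (simp add: ps_def)
    then have "\<forall>(u, v)\<in>set qs. (h j \<otimes> u, v) \<in> R" unfolding R_def by force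
    then show ?thesis using h[of j] j by (auto simp: N_def)
  qed
  ultimately show ?thesis using R_unique by (intro exI[of _ R]) blast
qed

text \<open>The symbol of a cell \<open>C\<close> at level \<open>Suc l\<close> with parent \<open>P\<close>. A reserved cell gets its prescribed symbol.
  The siblings of a reserved cell get a different symbol. If no sibling is reserved, one child of
  \<open>P\<close> gets \<open>2\<close> and the others get \<open>1\<close>. So if all children of \<open>P\<close> are
  filled at this level, they do not all get the same symbol.\<close>

definition fill_symbol :: "('a \<times> nat) set \<Rightarrow> nat \<Rightarrow> 'a set \<Rightarrow> 'a set \<Rightarrow> nat" where
  "fill_symbol R l P C =
     (let W = {w \<in> R. level (fst w) = Suc l \<and> fst w \<in> P} in
      if W \<noteq> {} then
        (let w = (SOME w. w \<in> W) in if fst w \<in> C then snd w else if snd w = 1 then 2 else 1)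
      else if (SOME u. u \<in> P) \<in> C then 2 else 1)"

definition filling :: "('a \<times> nat) set \<Rightarrow> 'a \<Rightarrow> nat" where
  "filling R = (\<lambda>g\<in>carrier G. case level g of 0 \<Rightarrow> 1
     | Suc l \<Rightarrow> fill_symbol R l (K l #> g) (K (Suc l) #> g))"

lemma filling_coset:
  assumes "g \<in> carrier G" "u \<in> K n #> g" "level g \<le> n"
  shows "filling R u = filling R g"
proof -
  have u: "u \<in> carrier G" using assms mem_coset_carrier by blast
  have "K m #> u = K m #> g" if "m \<le> n" for m
    using coset_antimono[OF that] coset_eq[OF assms(1)] assms(2) by blast
  then show ?thesis
    using level_coset[OF assms] u assms by (simp add: filling_def split: nat.split)
qed

lemma sibling_exists:
  assumes "g \<in> carrier G"
  shows "\<exists>u\<in>K l #> g. K (Suc l) #> u \<noteq> K (Suc l) #> g"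
proof -
  obtain h where h: "h \<in> K l" "h \<notin> K (Suc l)" using strict_step by blast
  have "h \<otimes> g \<notin> K (Suc l) #> g"
    using h assms subgroup.rcos_module[OF subgroup_K is_group] by (simp add: m_assoc)
  then show ?thesis
    using coset_left_mult[OF h(1) assms] coset_eq_iff assms coset_self K_mem_carrier[OF h(1)]
    by (metis m_closed)
qed

text \<open>Why every hole sees two symbols: if it meets every \<open>D M\<close>, then a single position in it is a request
  with either of the symbols \<open>1\<close> and \<open>2\<close>. Otherwise it contains a last hole, all of whose children
  are filled at once, and the rule for siblings makes these children differ.\<close>

theorem toeplitz_filling_exists:
  assumes "k \<ge> 2"
  shows "\<exists>x\<in>carrier G \<rightarrow>\<^sub>E {1..k}.
     (\<forall>n. \<forall>C\<in>rcosets (K n). x constant_on C \<longleftrightarrow> C \<notin> \<D> n) \<and>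
     (\<forall>(n, ps)\<in>requests k. \<exists>h\<in>K n. \<forall>(u, v)\<in>set ps. x (h \<otimes> u) = v)"
proof -
  obtain R where R: "R \<subseteq> carrier G \<times> {1..k}" "\<forall>w\<in>R. level (fst w) \<noteq> 0"
    and R_unique: "\<forall>w\<in>R. \<forall>w'\<in>R. \<forall>l. level (fst w) = Suc l \<longrightarrow> level (fst w') = Suc l \<longrightarrow>
        fst w' \<in> K l #> fst w \<longrightarrow> w = w'"
    and R_requests: "\<forall>(n, ps)\<in>requests k. \<exists>h\<in>K n. \<forall>(u, v)\<in>set ps. (h \<otimes> u, v) \<in> R"
    using reservations_exist[of k] by (elim exE conjE) (rule that)
  define x where "x = filling R"
  have fill_reserved: "x g = (if fst w \<in> K (Suc l) #> g then snd w else if snd w = 1 then 2 else 1)"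
    if g: "g \<in> carrier G" "level g = Suc l" and w: "w \<in> R" "level (fst w) = Suc l" "fst w \<in> K l #> g"
    for g w l
  proof -
    let ?W = "{w \<in> R. level (fst w) = Suc l \<and> fst w \<in> K l #> g}"
    have "?W = {w}"
    proof
      show "?W \<subseteq> {w}"
      proof
        fix w' assume w': "w' \<in> ?W"
        then have "fst w' \<in> K l #> fst w" using w g coset_eq by blast
        then show "w' \<in> {w}" using R_unique w w' by blast
      qed
    qed (use w in blast)
    then show ?thesis using g by (simp add: x_def filling_def fill_symbol_def Let_def)
  qed
  have fill_default: "x g = (if (SOME u. u \<in> K l #> g) \<in> K (Suc l) #> g then 2 else 1)"
    if g: "g \<in> carrier G" "level g = Suc l" and "\<not> (\<exists>w\<in>R. level (fst w) = Suc l \<and> fst w \<in> K l #> g)"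
    for g l
  proof -
    have "{w \<in> R. level (fst w) = Suc l \<and> fst w \<in> K l #> g} = {}" using that by blast
    then show ?thesis using g by (simp add: x_def filling_def fill_symbol_def Let_def)
  qed
  have x_R: "x (fst w) = snd w" if "w \<in> R" for w
  proof -
    have c: "fst w \<in> carrier G" using subsetD[OF R(1) that] by (simp add: mem_Times_iff)
    have "level (fst w) \<noteq> 0" using R(2) that by blast
    then obtain l where l: "level (fst w) = Suc l" using not0_implies_Suc by blast
    show ?thesis
      using fill_reserved[OF c l that l coset_self[OF c]] coset_self[OF c, of "Suc l"] by (simp only: if_True)
  qed
  have x_mem: "x \<in> carrier G \<rightarrow>\<^sub>E {1..k}"
  proof
    fix g assume g: "g \<in> carrier G"
    show "x g \<in> {1..k}"
    proof (cases "level g")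
      case 0
      then show ?thesis using g assms by (simp add: x_def filling_def)
    next
      case (Suc l)
      show ?thesis
      proof (cases "\<exists>w\<in>R. level (fst w) = Suc l \<and> fst w \<in> K l #> g")
        case True
        then obtain w where w: "w \<in> R" "level (fst w) = Suc l" "fst w \<in> K l #> g" by blast
        then have "snd w \<in> {1..k}" using subsetD[OF R(1) w(1)] by (simp add: mem_Times_iff)
        then show ?thesis using fill_reserved[OF g Suc w] assms by simp
      next
        case False
        then show ?thesis using fill_default[OF g Suc] assms by simp
      qed
    qed
  qed (simp add: x_def filling_def)
  have x_const: "x constant_on C" if C: "C \<in> rcosets (K n)" "C \<notin> \<D> n" for n C
  proof -
    obtain g where g: "g \<in> carrier G" "C = K n #> g" using C coset_exists_rep by blast
    then have "level g \<le> n" using C mem_D_iff[of g n] level_le_iff[of g n] by simp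
    then show ?thesis using filling_coset g by (auto simp: constant_on_def x_def)
  qed
  have realized: "\<exists>h\<in>K n. \<forall>(u, v)\<in>set ps. x (h \<otimes> u) = v" if "(n, ps) \<in> requests k" for n ps
    using R_requests that x_R by fastforce
  have x_nonconst: "\<not> x constant_on C" if C: "C \<in> \<D> n" for n C
  proof
    assume const: "x constant_on C"
    have Cr: "C \<in> rcosets (K n)" using C holes_rcosets by blast
    show False
    proof (cases "\<forall>M. C \<inter> D M \<noteq> {}")
      case True
      obtain g where g: "g \<in> carrier G" "C = K n #> g" using Cr coset_exists_rep by blast
      have gD: "g \<in> D n" using g C coset_self by blast
      have "(n, [(g, v)]) \<in> requests k" if "v \<in> {1, 2}" for v
      proof -
        have "\<exists>h\<in>K n. h \<otimes> g \<in> D M" for M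
        proof -
          obtain u where "u \<in> K n #> g" "u \<in> D M" using True g by blast
          moreover from \<open>u \<in> K n #> g\<close> obtain h where "h \<in> K n" "u = h \<otimes> g"
            by (rule mem_cosetE)
          ultimately show ?thesis by blast
        qed
        then show ?thesis using gD that assms by (auto simp: requests_def)
      qed
      then have "\<exists>h\<in>K n. x (h \<otimes> g) = v" if "v \<in> {1, 2}" for v
        using realized that by fastforce
      then have attained: "\<exists>u\<in>C. x u = v" if "v \<in> {1, 2}" for v
        using that g coset_left_mult by metis
      obtain u u' where "u \<in> C" "u' \<in> C" "x u = 1" "x u' = 2"
        using attained[of 1] attained[of 2] by auto
      then show False using const by (auto simp: constant_on_def)
    next
      case False
      then obtain M where M: "C \<inter> D M = {}" by blast
      \<comment> \<open>The deepest level at which the hole still contains holes.\<close>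
      define l where "l = (LEAST M. C \<inter> D (Suc M) = {})"
      have "D (Suc M) \<subseteq> D M" by (rule D_antimono) simp
      then have "C \<inter> D (Suc M) = {}" using M by auto
      from LeastI[of "\<lambda>M. C \<inter> D (Suc M) = {}", OF this] have l1: "C \<inter> D (Suc l) = {}"
        unfolding l_def .
      have "n \<le> l"
      proof (rule ccontr)
        assume "\<not> n \<le> l"
        then have "D n \<subseteq> D (Suc l)" by (intro D_antimono) simp
        moreover obtain u where "u \<in> C" using coset_nonempty[OF Cr] ..
        ultimately show False using l1 C by blast
      qed
      have "C \<inter> D l \<noteq> {}"
      proof (cases l)
        case 0
        obtain u where "u \<in> C" using coset_nonempty[OF Cr] ..
        then show ?thesis using 0 \<open>n \<le> l\<close> C by auto
      next
        case (Suc m)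
        then show ?thesis
          using not_less_Least[of m "\<lambda>M. C \<inter> D (Suc M) = {}"] unfolding l_def[symmetric] by simp
      qed
      then obtain g where g: "g \<in> C" "g \<in> D l" by blast
      have gc: "g \<in> carrier G" using g Cr coset_carrier by blast
      have sub: "K l #> g \<subseteq> C" using coset_antimono[OF \<open>n \<le> l\<close>] coset_rep[OF Cr g(1)] by blast
      have lev: "level u = Suc l" if "u \<in> K l #> g" for u
      proof -
        have "u \<in> D l" using mem_D_coset[OF gc that] g by simp
        moreover have "u \<notin> D (Suc l)" using that sub l1 by blast
        ultimately show ?thesis using level_le_iff less_level_iff by (meson Suc_leI le_antisym)
      qed
      have car: "u \<in> carrier G" if "u \<in> K l #> g" for u
        using mem_coset_carrier[OF that gc] .
      have par: "K l #> u = K l #> g" if "u \<in> K l #> g" for u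
        using coset_eq[OF gc that] .
      have "\<exists>u\<in>K l #> g. \<exists>u'\<in>K l #> g. x u \<noteq> x u'"
      proof (cases "\<exists>w\<in>R. level (fst w) = Suc l \<and> fst w \<in> K l #> g")
        case True
        then obtain w where w: "w \<in> R" "level (fst w) = Suc l" "fst w \<in> K l #> g" by blast
        obtain u where u: "u \<in> K l #> fst w" "K (Suc l) #> u \<noteq> K (Suc l) #> fst w"
          using sibling_exists car w by blast
        then have u': "u \<in> K l #> g" using par w by blast
        have "fst w \<notin> K (Suc l) #> u" using u coset_eq car[OF u'] by blast
        moreover have "x u = (if fst w \<in> K (Suc l) #> u then snd w else if snd w = 1 then 2 else 1)"
          using fill_reserved[OF car[OF u'] lev[OF u'] w(1,2)] w(3) par[OF u'] by simp
        ultimately have "x u \<noteq> x (fst w)" using x_R[OF w(1)] by simp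
        then show ?thesis using u' w by blast
      next
        case False
        define t where "t = (SOME u. u \<in> K l #> g)"
        have t: "t \<in> K l #> g" unfolding t_def using coset_self[OF gc] by (rule someI)
        have val: "x u = (if t \<in> K (Suc l) #> u then 2 else 1)" if "u \<in> K l #> g" for u
          using fill_default[OF car[OF that] lev[OF that]] False par[OF that] by (simp add: t_def)
        obtain u where u: "u \<in> K l #> t" "K (Suc l) #> u \<noteq> K (Suc l) #> t"
          using sibling_exists car t by blast
        then have u': "u \<in> K l #> g" using par t by blast
        have "t \<notin> K (Suc l) #> u" using u coset_eq car[OF u'] by blast
        then have "x u \<noteq> x t" using val[OF u'] val[OF t] coset_self[OF car[OF t]] by simp
        then show ?thesis using u' t by blast
      qed
      then show False using const sub by (auto simp: constant_on_def subset_iff)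
    qed
  qed
  show ?thesis
  proof (intro bexI[OF _ x_mem] conjI allI ballI)
    show "x constant_on C \<longleftrightarrow> C \<notin> \<D> n" if "C \<in> rcosets (K n)" for n C
      using x_const[OF that] x_nonconst by blast
    show "case r of (n, ps) \<Rightarrow> \<exists>h\<in>K n. \<forall>(u, v)\<in>set ps. x (h \<otimes> u) = v" if "r \<in> requests k" for r
      using realized that by (cases r) simp
  qed
qed

end

section \<open>Orbit closures in the full shift\<close>

lemma topspace_full_shift [simp]: "topspace (full_shift G k) = carrier G \<rightarrow>\<^sub>E {1..k}"
  by (simp add: full_shift_def)

lemma openin_cylinder:
  assumes "finite T"
  shows "openin (full_shift G k) {z \<in> carrier G \<rightarrow>\<^sub>E {1..k}. \<forall>t\<in>T. z t = y t}"
  unfolding full_shift_def openin_product_topology_alt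
proof
  fix z assume z: "z \<in> {z \<in> carrier G \<rightarrow>\<^sub>E {1..k}. \<forall>t\<in>T. z t = y t}"
  define U where "U i = (if i \<in> T then {z i} else {1..k})" for i
  have "finite {i \<in> carrier G. U i \<noteq> topspace (discrete_topology {1..k})}"
    by (rule finite_subset[OF _ assms]) (auto simp: U_def)
  moreover have "z \<in> carrier G \<rightarrow>\<^sub>E {1..k}" using z by blast
  then have "z \<in> Pi\<^sub>E (carrier G) U" "\<forall>i\<in>carrier G. openin (discrete_topology {1..k}) (U i)"
    by (auto simp: U_def PiE_iff)
  moreover have "Pi\<^sub>E (carrier G) U \<subseteq> {z \<in> carrier G \<rightarrow>\<^sub>E {1..k}. \<forall>t\<in>T. z t = y t}"
  proof
    fix w assume w: "w \<in> Pi\<^sub>E (carrier G) U"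
    have "w i \<in> {1..k}" if "i \<in> carrier G" for i
      using PiE_mem[OF w that] PiE_mem[OF \<open>z \<in> carrier G \<rightarrow>\<^sub>E {1..k}\<close> that]
      by (simp add: U_def split: if_splits)
    then have "w \<in> carrier G \<rightarrow>\<^sub>E {1..k}" using w by (simp add: PiE_iff)
    moreover have "w t = y t" if "t \<in> T" for t
    proof (cases "t \<in> carrier G")
      case True
      then show ?thesis using PiE_mem[OF w True] that z by (simp add: U_def)
    next
      case False
      then have "w t = z t" using w \<open>z \<in> carrier G \<rightarrow>\<^sub>E {1..k}\<close> PiE_arb by metis
      then show ?thesis using that z by simp
    qed
    ultimately show "w \<in> {z \<in> carrier G \<rightarrow>\<^sub>E {1..k}. \<forall>t\<in>T. z t = y t}" by blast
  qed
  ultimately show "\<exists>U. finite {i \<in> carrier G. U i \<noteq> topspace (discrete_topology {1..k})} \<and>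
      (\<forall>i\<in>carrier G. openin (discrete_topology {1..k}) (U i)) \<and> z \<in> Pi\<^sub>E (carrier G) U \<and>
      Pi\<^sub>E (carrier G) U \<subseteq> {z \<in> carrier G \<rightarrow>\<^sub>E {1..k}. \<forall>t\<in>T. z t = y t}"
    by blast
qed

lemma open_contains_cylinder:
  assumes "openin (full_shift G k) U" "y \<in> U"
  shows "\<exists>T. finite T \<and> T \<subseteq> carrier G \<and>
    (\<forall>z\<in>carrier G \<rightarrow>\<^sub>E {1..k}. (\<forall>t\<in>T. z t = y t) \<longrightarrow> z \<in> U)"
proof -
  obtain V where V: "finite {i \<in> carrier G. V i \<noteq> {1..k}}" "y \<in> Pi\<^sub>E (carrier G) V"
    "Pi\<^sub>E (carrier G) V \<subseteq> U"
    using assms unfolding full_shift_def openin_product_topology_alt topspace_discrete_topology by blast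
  have "z \<in> U" if z: "z \<in> carrier G \<rightarrow>\<^sub>E {1..k}" "\<forall>t\<in>{i \<in> carrier G. V i \<noteq> {1..k}}. z t = y t" for z
  proof -
    have "z i \<in> V i" if "i \<in> carrier G" for i
      using z that V(2) by (cases "V i = {1..k}") (auto simp: PiE_iff)
    then have "z \<in> Pi\<^sub>E (carrier G) V" using z(1) by (simp add: PiE_iff)
    then show ?thesis using V(3) by blast
  qed
  then show ?thesis using V(1) by (intro exI[of _ "{i \<in> carrier G. V i \<noteq> {1..k}}"]) auto
qed

locale orbit_system = group G for G (structure) +
  fixes k :: nat and x :: "'a \<Rightarrow> nat"
  assumes point: "x \<in> carrier G \<rightarrow>\<^sub>E {1..k}"
begin

abbreviation X :: "('a \<Rightarrow> nat) topology" where "X \<equiv> orbit_closure G k x"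

lemma shift_apply: "h \<in> carrier G \<Longrightarrow> shift G g y h = y (inv g \<otimes> h)"
  by (simp add: shift_def)

lemma shift_full: "y \<in> carrier G \<rightarrow>\<^sub>E {1..k} \<Longrightarrow> g \<in> carrier G \<Longrightarrow> shift G g y \<in> carrier G \<rightarrow>\<^sub>E {1..k}"
  by (auto simp: shift_def PiE_iff)

text \<open>The patterns of the orbit closure on finite windows are those of \<open>x\<close>. The counting arguments use the
  closure in this form.\<close>

lemma mem_orbit_closure:
  "y \<in> topspace X \<longleftrightarrow> y \<in> carrier G \<rightarrow>\<^sub>E {1..k} \<and>
     (\<forall>T. finite T \<longrightarrow> T \<subseteq> carrier G \<longrightarrow> (\<exists>g\<in>carrier G. \<forall>t\<in>T. y t = x (inv g \<otimes> t)))"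
    (is "?L \<longleftrightarrow> ?R")
proof
  assume L: ?L
  then have y: "y \<in> carrier G \<rightarrow>\<^sub>E {1..k}"
    and cl: "\<And>U. y \<in> U \<Longrightarrow> openin (full_shift G k) U \<Longrightarrow> \<exists>z\<in>orbit G (shift G) x. z \<in> U"
    by (auto simp: orbit_closure_def in_closure_of Bex_def)
  have "\<exists>g\<in>carrier G. \<forall>t\<in>T. y t = x (inv g \<otimes> t)" if T: "finite T" "T \<subseteq> carrier G" for T
  proof -
    obtain z where z: "z \<in> orbit G (shift G) x" "\<forall>t\<in>T. z t = y t"
      using cl[OF _ openin_cylinder[OF T(1), of G k y]] y by blast
    then obtain g where "g \<in> carrier G" "z = shift G g x" by (auto simp: orbit_def)
    then have "\<forall>t\<in>T. y t = x (inv g \<otimes> t)" using z T(2) shift_apply by (metis subsetD)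
    then show ?thesis using \<open>g \<in> carrier G\<close> by blast
  qed
  then show ?R using y by blast
next
  assume R: ?R
  have "\<exists>z. z \<in> orbit G (shift G) x \<and> z \<in> U" if U: "y \<in> U" "openin (full_shift G k) U" for U
  proof -
    obtain T where T: "finite T" "T \<subseteq> carrier G"
      "\<And>z. z \<in> carrier G \<rightarrow>\<^sub>E {1..k} \<Longrightarrow> (\<forall>t\<in>T. z t = y t) \<Longrightarrow> z \<in> U"
      using open_contains_cylinder[OF U(2,1)] by blast
    obtain g where g: "g \<in> carrier G" "\<forall>t\<in>T. y t = x (inv g \<otimes> t)" using R T(1,2) by blast
    have "shift G g x \<in> U"
    proof (intro T(3) shift_full point g ballI)
      fix t assume "t \<in> T"
      then show "shift G g x t = y t" using g(2) subsetD[OF T(2)] by (simp add: shift_apply)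
    qed
    then show ?thesis using g by (auto simp: orbit_def)
  qed
  then show ?L using R by (auto simp: orbit_closure_def in_closure_of)
qed

lemma orbit_closure_subset: "y \<in> topspace X \<Longrightarrow> y \<in> carrier G \<rightarrow>\<^sub>E {1..k}"
  using mem_orbit_closure by blast

lemma symbol_mem: "y \<in> topspace X \<Longrightarrow> h \<in> carrier G \<Longrightarrow> y h \<in> {1..k}"
  using orbit_closure_subset PiE_mem by metis

lemma orbit_subset: "g \<in> carrier G \<Longrightarrow> shift G g x \<in> topspace X"
  unfolding mem_orbit_closure using shift_full[OF point] shift_apply by blast

lemma shift_closed:
  assumes "y \<in> topspace X" "s \<in> carrier G"
  shows "shift G s y \<in> topspace X"
  unfolding mem_orbit_closure
proof (intro conjI allI impI)
  show "shift G s y \<in> carrier G \<rightarrow>\<^sub>E {1..k}" using assms shift_full orbit_closure_subset by blast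
  fix T assume T: "finite T" "T \<subseteq> carrier G"
  then have "finite ((\<lambda>t. inv s \<otimes> t) ` T)" "(\<lambda>t. inv s \<otimes> t) ` T \<subseteq> carrier G"
    using assms by auto
  then obtain g where g: "g \<in> carrier G" "\<forall>t\<in>T. y (inv s \<otimes> t) = x (inv g \<otimes> (inv s \<otimes> t))"
    using assms(1) unfolding mem_orbit_closure by (metis (no_types, lifting) image_eqI)
  have "shift G s y t = x (inv (s \<otimes> g) \<otimes> t)" if "t \<in> T" for t
    using g that T assms shift_apply[of t s y] by (auto simp: inv_mult_group m_assoc subset_iff)
  then show "\<exists>g\<in>carrier G. \<forall>t\<in>T. shift G s y t = x (inv g \<otimes> t)"
    using g assms by blast
qed

lemma shift_mult:
  assumes "s \<in> carrier G" "t \<in> carrier G"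
  shows "shift G (s \<otimes> t) y = shift G s (shift G t y)"
  using assms by (auto simp: shift_def inv_mult_group m_assoc)

lemma shift_inv_at_one: "h \<in> carrier G \<Longrightarrow> shift G (inv h) y \<one> = y h"
  by (simp add: shift_apply)

lemma compact_space_orbit_closure: "compact_space X"
  unfolding orbit_closure_def
proof (rule compact_space_subtopology, rule closedin_compact_space)
  show "compact_space (full_shift G k)"
    by (simp add: full_shift_def compact_space_product_topology compact_space_discrete_topology)
qed simp

lemma openin_orbit_cylinder:
  assumes "finite T"
  shows "openin X {z \<in> topspace X. \<forall>t\<in>T. z t = y t}"
proof -
  have "{z \<in> topspace X. \<forall>t\<in>T. z t = y t}
      = {z \<in> carrier G \<rightarrow>\<^sub>E {1..k}. \<forall>t\<in>T. z t = y t} \<inter> (full_shift G k) closure_of (orbit G (shift G) x)"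
    by (auto simp: orbit_closure_def)
  then show ?thesis
    using openin_cylinder[OF assms, of G k y] unfolding orbit_closure_def openin_subtopology by blast
qed

lemma orbit_open_contains_cylinder:
  assumes "openin X U" "y \<in> U"
  shows "\<exists>T. finite T \<and> T \<subseteq> carrier G \<and> (\<forall>z\<in>topspace X. (\<forall>t\<in>T. z t = y t) \<longrightarrow> z \<in> U)"
proof -
  obtain V where V: "openin (full_shift G k) V"
    "U = V \<inter> (full_shift G k) closure_of (orbit G (shift G) x)"
    using assms(1) unfolding orbit_closure_def openin_subtopology by blast
  have "y \<in> V" using assms(2) V(2) by blast
  from open_contains_cylinder[OF V(1) this] obtain T where T: "finite T" "T \<subseteq> carrier G"
    and in_V: "\<And>z. z \<in> carrier G \<rightarrow>\<^sub>E {1..k} \<Longrightarrow> (\<forall>t\<in>T. z t = y t) \<Longrightarrow> z \<in> V"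
    by blast
  show ?thesis
  proof (intro exI[of _ T] conjI T ballI impI)
    fix z assume z: "z \<in> topspace X" "\<forall>t\<in>T. z t = y t"
    have "z \<in> V" using in_V[OF orbit_closure_subset[OF z(1)] z(2)] .
    moreover have "z \<in> full_shift G k closure_of orbit G (shift G) x"
      using z(1) by (simp add: orbit_closure_def)
    ultimately show "z \<in> U" using V(2) by blast
  qed
qed

lemma continuous_map_shift:
  assumes "s \<in> carrier G"
  shows "continuous_map X X (shift G s)"
proof -
  have preimage: "openin X {z \<in> topspace X. shift G s z \<in> U}" if U: "openin X U" for U
  proof (subst openin_subopen, intro ballI)
    fix z assume z: "z \<in> {z \<in> topspace X. shift G s z \<in> U}"
    then obtain T where T: "finite T" "T \<subseteq> carrier G"
      "\<forall>w\<in>topspace X. (\<forall>t\<in>T. w t = shift G s z t) \<longrightarrow> w \<in> U"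
      using orbit_open_contains_cylinder[OF U, of "shift G s z"] by blast
    let ?C = "{w \<in> topspace X. \<forall>t\<in>(\<lambda>t. inv s \<otimes> t) ` T. w t = z t}"
    have "openin X ?C" using T by (intro openin_orbit_cylinder) auto
    moreover have "?C \<subseteq> {z \<in> topspace X. shift G s z \<in> U}"
    proof
      fix w assume w: "w \<in> ?C"
      then have "\<forall>t\<in>T. shift G s w t = shift G s z t"
        using T(2) by (auto simp: shift_apply subset_iff)
      then show "w \<in> {z \<in> topspace X. shift G s z \<in> U}"
        using T(3) w shift_closed assms by blast
    qed
    ultimately show "\<exists>T. openin X T \<and> z \<in> T \<and> T \<subseteq> {z \<in> topspace X. shift G s z \<in> U}"
      using z by (intro exI[of _ ?C]) auto
  qed
  show ?thesis unfolding continuous_map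
  proof (intro conjI allI impI preimage)
    show "shift G s ` topspace X \<subseteq> topspace X" using shift_closed assms by (simp add: image_subset_iff)
  qed
qed

section \<open>Generating pseudometrics and coordinates\<close>

context
  fixes d :: "('a \<Rightarrow> nat) \<Rightarrow> ('a \<Rightarrow> nat) \<Rightarrow> real"
  assumes gen: "generating_pseudometric G X (shift G) d"
begin

lemma pseudometric:
  assumes "y \<in> topspace X" "z \<in> topspace X"
  shows "d y y = 0" "0 \<le> d y z" "d y z \<le> 1" "d y z = d z y"
proof -
  note g = gen[unfolded generating_pseudometric_def]
  show "d y y = 0" by (rule bspec[OF conjunct1[OF g] assms(1)])
  note bounds = bspec[OF bspec[OF conjunct1[OF conjunct2[OF g]] assms(1)] assms(2)]
  show "0 \<le> d y z" by (rule conjunct1[OF bounds])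
  show "d y z \<le> 1" by (rule conjunct1[OF conjunct2[OF bounds]])
  show "d y z = d z y" by (rule conjunct2[OF conjunct2[OF bounds]])
qed

lemma pseudometric_triangle:
  "\<lbrakk>y \<in> topspace X; z \<in> topspace X; w \<in> topspace X\<rbrakk> \<Longrightarrow> d y w \<le> d y z + d z w"
  by (rule bspec[OF bspec[OF bspec[OF
    conjunct1[OF conjunct2[OF conjunct2[OF gen[unfolded generating_pseudometric_def]]]]]]])

text \<open>Every point has a cylinder neighbourhood of small diameter. By compactness finitely many of these
  cylinders suffice, and their windows can be combined.\<close>

lemma close_if_agree:
  assumes "\<epsilon> > 0"
  shows "\<exists>E. finite E \<and> E \<subseteq> carrier G \<and>
    (\<forall>y\<in>topspace X. \<forall>z\<in>topspace X. (\<forall>e\<in>E. y e = z e) \<longrightarrow> d y z < \<epsilon>)"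
proof -
  have "\<exists>E. finite E \<and> E \<subseteq> carrier G \<and> (\<forall>z\<in>topspace X. (\<forall>e\<in>E. z e = y e) \<longrightarrow> d y z < \<epsilon> / 2)"
    if y: "y \<in> topspace X" for y
  proof -
    have "continuous_map X euclideanreal ((\<lambda>(y, z). d y z) \<circ> (\<lambda>z. (y, z)))"
    proof (rule continuous_map_compose)
      show "continuous_map X (prod_topology X X) (\<lambda>z. (y, z))"
        using y by (intro continuous_map_pairedI) auto
      show "continuous_map (prod_topology X X) euclideanreal (\<lambda>(y, z). d y z)"
        using gen by (simp add: generating_pseudometric_def)
    qed
    then have "openin X {z \<in> topspace X. ((\<lambda>(y, z). d y z) \<circ> (\<lambda>z. (y, z))) z \<in> {..<\<epsilon> / 2}}"
      by (rule openin_continuous_map_preimage) (simp flip: open_openin)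
    then have "openin X {z \<in> topspace X. d y z < \<epsilon> / 2}" by simp
    from orbit_open_contains_cylinder[OF this, of y] show ?thesis
      using y assms pseudometric(1)[OF y y] by auto
  qed
  then obtain E where E: "\<And>y. y \<in> topspace X \<Longrightarrow> finite (E y) \<and> E y \<subseteq> carrier G \<and>
      (\<forall>z\<in>topspace X. (\<forall>e\<in>E y. z e = y e) \<longrightarrow> d y z < \<epsilon> / 2)"
    by metis
  define cyl where "cyl y = {z \<in> topspace X. \<forall>e\<in>E y. z e = y e}" for y
  have "\<exists>\<F>. finite \<F> \<and> \<F> \<subseteq> cyl ` topspace X \<and> topspace X \<subseteq> \<Union>\<F>"
  proof -
    have "\<forall>U\<in>cyl ` topspace X. openin X U"
      using E openin_orbit_cylinder by (auto simp: cyl_def)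
    moreover have "topspace X \<subseteq> \<Union>(cyl ` topspace X)" by (auto simp: cyl_def)
    ultimately show ?thesis
      using compact_space_orbit_closure unfolding compact_space_alt by blast
  qed
  then obtain Y where Y: "finite Y" "Y \<subseteq> topspace X" "topspace X \<subseteq> \<Union>(cyl ` Y)"
    using finite_subset_image by metis
  have close: "d u v < \<epsilon>" if uv: "u \<in> topspace X" "v \<in> topspace X" "\<forall>e\<in>\<Union>(E ` Y). u e = v e" for u v
  proof -
    obtain y where y: "y \<in> Y" "u \<in> cyl y" using Y uv(1) by blast
    then have "v \<in> cyl y" using uv by (auto simp: cyl_def)
    then have "d y u < \<epsilon> / 2" "d y v < \<epsilon> / 2" using E Y(2) y by (auto simp: cyl_def)
    moreover have "d u v \<le> d u y + d y v" "d u y = d y u"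
      using pseudometric_triangle pseudometric(4) uv y Y(2) by blast+
    ultimately show ?thesis by simp
  qed
  have EY: "finite (E y)" "E y \<subseteq> carrier G" if "y \<in> Y" for y
    using E[OF subsetD[OF Y(2) that]] by simp_all
  show ?thesis
  proof (intro exI[of _ "\<Union>(E ` Y)"] conjI ballI impI)
    show "finite (\<Union>(E ` Y))" using Y(1) EY(1) by (rule finite_UN_I)
    show "\<Union>(E ` Y) \<subseteq> carrier G" using EY(2) by (rule UN_least)
  next
    fix y z assume "y \<in> topspace X" "z \<in> topspace X" "\<forall>e\<in>\<Union>(E ` Y). y e = z e"
    then show "d y z < \<epsilon>" by (rule close)
  qed
qed

text \<open>The pairs of points with different symbols at \<open>\<one>\<close> form a compact set, and by the generating property
  each of them is separated by some translate. So finitely many translates and one bound suffice.\<close>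

lemma separated_if_differ:
  "\<exists>S \<kappa>. finite S \<and> S \<subseteq> carrier G \<and> \<kappa> > 0 \<and>
     (\<forall>y\<in>topspace X. \<forall>z\<in>topspace X. y \<one> \<noteq> z \<one> \<longrightarrow> (\<exists>t\<in>S. d (shift G t y) (shift G t z) > \<kappa>))"
proof -
  define V where "V = (\<lambda>(t, m). {p \<in> topspace X \<times> topspace X.
      d (shift G t (fst p)) (shift G t (snd p)) > 1 / real (Suc m)})"
  define E where "E = {p \<in> topspace X \<times> topspace X. fst p \<one> = snd p \<one>}"
  define \<U> where "\<U> = insert E (V ` (carrier G \<times> UNIV))"
  have "openin (prod_topology X X) E"
  proof -
    have "E = (\<Union>y\<in>topspace X. {z \<in> topspace X. \<forall>t\<in>{\<one>}. z t = y t} \<times> {z \<in> topspace X. \<forall>t\<in>{\<one>}. z t = y t})"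
      by (auto simp: E_def)
    then show ?thesis
      using openin_orbit_cylinder[of "{\<one>}"] by (auto intro!: openin_Union simp: openin_prod_Times_iff)
  qed
  moreover have "openin (prod_topology X X) (V (t, m))" if "t \<in> carrier G" for t m
  proof -
    have "continuous_map (prod_topology X X) euclideanreal
      ((\<lambda>(y, z). d y z) \<circ> (\<lambda>p. (shift G t (fst p), shift G t (snd p))))"
    proof (rule continuous_map_compose)
      have "continuous_map (prod_topology X X) X (shift G t \<circ> fst)"
        "continuous_map (prod_topology X X) X (shift G t \<circ> snd)"
        using continuous_map_shift[OF that] continuous_map_fst continuous_map_snd
        by (blast intro: continuous_map_compose)+
      then show "continuous_map (prod_topology X X) (prod_topology X X)
          (\<lambda>p. (shift G t (fst p), shift G t (snd p)))"
        by (intro continuous_map_pairedI) (simp_all add: o_def)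
      show "continuous_map (prod_topology X X) euclideanreal (\<lambda>(y, z). d y z)"
        using gen by (simp add: generating_pseudometric_def)
    qed
    then have "openin (prod_topology X X) {p \<in> topspace (prod_topology X X).
       ((\<lambda>(y, z). d y z) \<circ> (\<lambda>p. (shift G t (fst p), shift G t (snd p)))) p \<in> {1 / real (Suc m)<..}}"
      by (rule openin_continuous_map_preimage) (simp flip: open_openin)
    then show ?thesis by (simp add: V_def)
  qed
  ultimately have "\<forall>U\<in>\<U>. openin (prod_topology X X) U" by (auto simp: \<U>_def)
  moreover have "topspace (prod_topology X X) \<subseteq> \<Union>\<U>"
  proof
    fix p assume "p \<in> topspace (prod_topology X X)"
    then have p: "fst p \<in> topspace X" "snd p \<in> topspace X" by (auto simp: mem_Times_iff)
    show "p \<in> \<Union>\<U>"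
    proof (cases "fst p = snd p")
      case True
      then show ?thesis using p by (auto simp: \<U>_def E_def mem_Times_iff)
    next
      case False
      then obtain t where t: "t \<in> carrier G" "d (shift G t (fst p)) (shift G t (snd p)) > 0"
        using gen p unfolding generating_pseudometric_def by blast
      then obtain m where "1 / real (Suc m) < d (shift G t (fst p)) (shift G t (snd p))"
        using reals_Archimedean by (auto simp: inverse_eq_divide)
      then have "p \<in> V (t, m)" using p by (simp add: V_def mem_Times_iff)
      then show ?thesis using t by (auto simp: \<U>_def)
    qed
  qed
  moreover have "compact_space (prod_topology X X)"
    using compact_space_orbit_closure by (simp add: compact_space_prod_topology)
  ultimately obtain \<F> where \<F>: "finite \<F>" "\<F> \<subseteq> \<U>" "topspace (prod_topology X X) \<subseteq> \<Union>\<F>"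
    unfolding compact_space_alt by meson
  have "finite (\<F> - {E})" "\<F> - {E} \<subseteq> V ` (carrier G \<times> UNIV)" using \<F> by (auto simp: \<U>_def)
  then obtain J where J: "finite J" "J \<subseteq> carrier G \<times> UNIV" "\<F> - {E} = V ` J"
    using finite_subset_image by metis
  define m0 where "m0 = Max (insert 0 (snd ` J))"
  have separated: "\<exists>t\<in>fst ` J. d (shift G t y) (shift G t z) > 1 / real (Suc m0)"
    if yz: "y \<in> topspace X" "z \<in> topspace X" "y \<one> \<noteq> z \<one>" for y z
  proof -
    have "(y, z) \<in> \<Union>\<F>" using \<F>(3) yz by auto
    moreover have "(y, z) \<notin> E" using yz by (simp add: E_def)
    ultimately have "(y, z) \<in> \<Union>(V ` J)" using J(3) by blast
    then obtain t m where tm: "(t, m) \<in> J" "(y, z) \<in> V (t, m)" by auto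
    have "m \<le> m0" unfolding m0_def using tm(1) J(1) by (intro Max_ge) force+
    then have "1 / real (Suc m0) \<le> 1 / real (Suc m)" by (simp add: frac_le)
    also have "\<dots> < d (shift G t y) (shift G t z)" using tm(2) by (simp add: V_def)
    finally show ?thesis using tm(1) by force
  qed
  show ?thesis
  proof (intro exI[of _ "fst ` J"] exI[of _ "1 / real (Suc m0)"] conjI ballI impI)
    show "finite (fst ` J)" "fst ` J \<subseteq> carrier G" using J by auto
    show "0 < 1 / real (Suc m0)" by simp
    fix y z assume "y \<in> topspace X" "z \<in> topspace X" "y \<one> \<noteq> z \<one>"
    then show "\<exists>t\<in>fst ` J. d (shift G t y) (shift G t z) > 1 / real (Suc m0)" by (rule separated)
  qed
qed

end

text \<open>Sofic entropy is defined as the value common to all generating pseudometrics, and this determines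
  it only if there is one.\<close>

lemma generating_pseudometric_exists:
  "generating_pseudometric G X (shift G) (\<lambda>y z. if y \<one> = z \<one> then 0 else 1)"
  unfolding generating_pseudometric_def
proof (intro conjI ballI impI)
  have "continuous_map (prod_topology X X) (prod_topology (discrete_topology {1..k}) (discrete_topology {1..k}))
      (\<lambda>p. (fst p \<one>, snd p \<one>))"
  proof -
    have c: "continuous_map X (discrete_topology {1..k}) (\<lambda>z. z \<one>)"
      unfolding orbit_closure_def full_shift_def
      by (intro continuous_map_from_subtopology continuous_map_product_projection) simp
    have "continuous_map (prod_topology X X) (discrete_topology {1..k}) ((\<lambda>z. z \<one>) \<circ> fst)"
      "continuous_map (prod_topology X X) (discrete_topology {1..k}) ((\<lambda>z. z \<one>) \<circ> snd)"
      using c continuous_map_fst continuous_map_snd by (blast intro: continuous_map_compose)+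
    then show ?thesis by (intro continuous_map_pairedI) (simp_all add: o_def)
  qed
  then have c: "continuous_map (prod_topology X X) (discrete_topology ({1..k} \<times> {1..k})) (\<lambda>p. (fst p \<one>, snd p \<one>))"
    by (simp add: prod_topology_discrete_topology)
  have "continuous_map (discrete_topology ({1..k} \<times> {1..k})) euclideanreal (\<lambda>(a, b). if a = b then 0 else 1)"
    by simp
  from continuous_map_compose[OF c this]
  show "continuous_map (prod_topology X X) euclideanreal (\<lambda>(y, z). if y \<one> = z \<one> then 0 else 1)"
    unfolding o_def case_prod_beta fst_conv snd_conv .
next
  fix y z assume y: "y \<in> topspace X" and z: "z \<in> topspace X" and "y \<noteq> z"
  then obtain h where h: "h \<in> carrier G" "y h \<noteq> z h"
    using PiE_ext[OF orbit_closure_subset[OF y] orbit_closure_subset[OF z]] by blast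
  then have "shift G (inv h) y \<one> \<noteq> shift G (inv h) z \<one>"
    unfolding shift_inv_at_one[OF h(1)] by blast
  then show "\<exists>s\<in>carrier G. 0 < (if shift G s y \<one> = shift G s z \<one> then 0 else (1::real))"
    using \<open>h \<in> carrier G\<close> by (intro bexI[of _ "inv h"]) simp_all
qed simp_all

end

section \<open>Counting and averaging estimates\<close>

text \<open>Weighting a subset \<open>B\<close> by \<open>t ^ card B\<close> makes the total weight \<open>(1 + t) ^ card V\<close>, and each small subset has
  weight at least \<open>t powr (\<beta> * card V)\<close>. For small \<open>t\<close> and much smaller \<open>\<beta>\<close> the growth rate is close to \<open>0\<close>.\<close>

lemma card_small_subsets:
  fixes \<beta> t :: real
  assumes "finite V" "0 < t" "t \<le> 1"
  shows "real (card {B. B \<subseteq> V \<and> real (card B) \<le> \<beta> * real (card V)})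
     \<le> exp (real (card V) * (\<beta> * ln (1 / t) + t))"
proof -
  define N where "N = real (card V)"
  let ?F = "{B. B \<subseteq> V \<and> real (card B) \<le> \<beta> * N}"
  have fin: "finite ?F" by (rule finite_subset[of _ "Pow V"]) (use assms in auto)
  have le: "t powr (\<beta> * N) \<le> t ^ card B" if "B \<in> ?F" for B
  proof -
    have "t powr (\<beta> * N) \<le> t powr (real (card B))"
      using assms that by (intro powr_mono') auto
    then show ?thesis using assms by (simp add: powr_realpow)
  qed
  have "real (card ?F) * t powr (\<beta> * N) = (\<Sum>B\<in>?F. t powr (\<beta> * N))" by simp
  also have "\<dots> \<le> (\<Sum>B\<in>?F. t ^ card B)" by (rule sum_mono) (rule le)
  also have "\<dots> \<le> (\<Sum>B\<in>Pow V. t ^ card B)"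
    using assms by (intro sum_mono2) auto
  also have "\<dots> = (\<Prod>v\<in>V. t + 1)"
    using prod_add[OF assms(1), of "\<lambda>_. t" "\<lambda>_. 1"] by simp
  also have "\<dots> = (1 + t) ^ card V" by (simp add: add.commute)
  also have "\<dots> \<le> exp t ^ card V"
    using assms exp_ge_add_one_self[of t] by (intro power_mono) auto
  also have "\<dots> = exp (N * t)" by (simp add: N_def exp_of_nat_mult)
  finally have "real (card ?F) \<le> exp (N * t) / t powr (\<beta> * N)"
    using assms by (simp add: pos_le_divide_eq)
  also have "\<dots> = exp (N * (\<beta> * ln (1 / t) + t))"
    using assms by (simp add: powr_def exp_diff[symmetric] ln_div algebra_simps)
  finally show ?thesis by (simp add: N_def)
qed

lemma dist2_markov:
  assumes "finite V" "\<eta> > 0" "dist2 d V f g \<le> \<delta>"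
  shows "real (card {v \<in> V. d (f v) (g v) > \<eta>}) \<le> (\<delta> / \<eta>)\<^sup>2 * real (card V)"
proof (cases "V = {}")
  case False
  then have V: "real (card V) > 0" using assms(1) by (simp add: card_gt_0_iff)
  let ?B = "{v \<in> V. d (f v) (g v) > \<eta>}"
  have "(\<Sum>v\<in>V. (d (f v) (g v))\<^sup>2) / real (card V) \<le> \<delta>\<^sup>2"
    using assms(3) sqrt_le_D unfolding dist2_def by blast
  then have total: "(\<Sum>v\<in>V. (d (f v) (g v))\<^sup>2) \<le> \<delta>\<^sup>2 * real (card V)"
    using V by (simp add: pos_divide_le_eq)
  have "real (card ?B) * \<eta>\<^sup>2 = (\<Sum>v\<in>?B. \<eta>\<^sup>2)" by simp
  also have "\<dots> \<le> (\<Sum>v\<in>?B. (d (f v) (g v))\<^sup>2)"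
    using assms(2) by (intro sum_mono power_mono) auto
  also have "\<dots> \<le> (\<Sum>v\<in>V. (d (f v) (g v))\<^sup>2)"
    using assms(1) by (intro sum_mono2) auto
  finally have "real (card ?B) * \<eta>\<^sup>2 \<le> \<delta>\<^sup>2 * real (card V)" using total by linarith
  then show ?thesis using assms(2) by (simp add: power_divide field_simps)
qed simp

lemma dist2_le_if_mostly_close:
  assumes V: "finite V" "V \<noteq> {}" and B: "B \<subseteq> V" and \<delta>: "\<delta> \<ge> 0"
    and bound: "\<And>v. v \<in> V \<Longrightarrow> 0 \<le> d (f v) (g v) \<and> d (f v) (g v) \<le> 1"
    and close: "\<And>v. v \<in> V - B \<Longrightarrow> d (f v) (g v) \<le> \<eta>"
    and size: "\<eta>\<^sup>2 + real (card B) / real (card V) \<le> \<delta>\<^sup>2"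
  shows "dist2 d V f g \<le> \<delta>"
proof -
  have pos: "real (card V) > 0" using V by (simp add: card_gt_0_iff)
  have "(\<Sum>v\<in>V. (d (f v) (g v))\<^sup>2) \<le> (\<Sum>v\<in>V. \<eta>\<^sup>2 + (if v \<in> B then 1 else 0))"
  proof (rule sum_mono)
    fix v assume v: "v \<in> V"
    show "(d (f v) (g v))\<^sup>2 \<le> \<eta>\<^sup>2 + (if v \<in> B then 1 else 0)"
    proof (cases "v \<in> B")
      case True
      have "(d (f v) (g v))\<^sup>2 \<le> 1" using bound[OF v] by (simp add: power_le_one)
      then show ?thesis using True by (simp add: add_increasing)
    next
      case False
      then show ?thesis using bound[OF v] close[of v] v by (simp add: power_mono)
    qed
  qed
  also have "\<dots> = real (card V) * \<eta>\<^sup>2 + real (card B)"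
    using V B by (simp add: sum.distrib sum.If_cases Int_absorb1)
  finally have "(\<Sum>v\<in>V. (d (f v) (g v))\<^sup>2) / real (card V) \<le> \<eta>\<^sup>2 + real (card B) / real (card V)"
    using pos by (simp add: field_simps)
  then show ?thesis
    unfolding dist2_def using size \<delta> by (intro real_le_lsqrt) (auto intro: order_trans)
qed

definition separated_set :: "real \<Rightarrow> ('b \<Rightarrow> 'b \<Rightarrow> real) \<Rightarrow> 'b set \<Rightarrow> bool" where
  "separated_set \<epsilon> \<rho> A \<longleftrightarrow> finite A \<and> (\<forall>a\<in>A. \<forall>b\<in>A. a \<noteq> b \<longrightarrow> \<rho> a b > \<epsilon>)"

lemma log_card_sep_number_le:
  assumes "\<And>A. A \<subseteq> Y \<Longrightarrow> separated_set \<epsilon> \<rho> A \<Longrightarrow> real (card A) \<le> exp r"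
  shows "log_card (sep_number \<epsilon> Y \<rho>) \<le> ereal r"
proof -
  have "sep_number \<epsilon> Y \<rho> \<le> enat (nat \<lfloor>exp r\<rfloor>)"
    unfolding sep_number_def
  proof (rule SUP_least)
    fix A assume "A \<in> {A. A \<subseteq> Y \<and> finite A \<and> (\<forall>a\<in>A. \<forall>b\<in>A. a \<noteq> b \<longrightarrow> \<rho> a b > \<epsilon>)}"
    then have "real (card A) \<le> exp r" using assms by (simp add: separated_set_def)
    then show "enat (card A) \<le> enat (nat \<lfloor>exp r\<rfloor>)" by (simp add: le_nat_floor)
  qed
  then obtain m where m: "sep_number \<epsilon> Y \<rho> = enat m" "m \<le> nat \<lfloor>exp r\<rfloor>"
    by (metis enat_ile enat_ord_simps(1))
  have "real m \<le> exp r"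
    using m(2) by (meson exp_ge_zero of_nat_floor of_nat_le_iff order_trans)
  then have "ln (real m) \<le> r" if "m \<noteq> 0"
    using that by (metis exp_ge_zero exp_le_cancel_iff exp_ln neq0_conv of_nat_0_less_iff)
  then show ?thesis by (simp add: m(1) log_card_def)
qed

lemma log_card_sep_number_ge:
  assumes "A \<subseteq> Y" "separated_set \<epsilon> \<rho> A" "A \<noteq> {}"
  shows "ereal (ln (real (card A))) \<le> log_card (sep_number \<epsilon> Y \<rho>)"
proof -
  have le: "enat (card A) \<le> sep_number \<epsilon> Y \<rho>"
    unfolding sep_number_def using assms by (intro SUP_upper) (simp add: separated_set_def)
  have pos: "card A > 0" using assms by (simp add: card_gt_0_iff separated_set_def)
  show ?thesis
  proof (cases "sep_number \<epsilon> Y \<rho>")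
    case (enat m)
    then have "card A \<le> m" using le by simp
    then show ?thesis using pos enat by (simp add: log_card_def)
  qed (simp add: log_card_def)
qed

section \<open>Toeplitz arrays with freely filled holes\<close>

text \<open>All that the entropy computation uses about \<open>x\<close>.\<close>

locale toeplitz_array = hole_system G K \<D> + orbit_system G k x
  for G (structure) and K :: "nat \<Rightarrow> 'a set" and \<D> and k and x +
  fixes \<theta> :: real
  assumes k_pos: "k \<ge> 1"
    and const_off_holes: "C \<in> rcosets (K n) \<Longrightarrow> C \<notin> \<D> n \<Longrightarrow> x constant_on C"
    and requests_realized: "(n, ps) \<in> requests k \<Longrightarrow> \<exists>h\<in>K n. \<forall>(u, v)\<in>set ps. x (h \<otimes> u) = v"
    and hole_density: "(\<lambda>n. real (card (\<D> n)) / real (index n)) \<longlonglongrightarrow> \<theta>"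
begin

abbreviation V :: "nat \<Rightarrow> 'a set set" where "V n \<equiv> rcosets (K n)"
abbreviation act :: "nat \<Rightarrow> 'a \<Rightarrow> 'a set \<Rightarrow> 'a set" where "act n \<equiv> coset_action G (K n)"

lemma card_V: "card (V n) = index n"
  by (simp add: subgroup_index_def)

lemma V_nonempty: "V n \<noteq> {}"
  using cosetI[OF one_closed] by blast

definition coset_value :: "'a set \<Rightarrow> nat" where
  "coset_value C = x (SOME u. u \<in> C)"

lemma coset_value:
  assumes "C \<in> V n" "C \<notin> \<D> n" "u \<in> C"
  shows "x u = coset_value C"
proof -
  have "(SOME u. u \<in> C) \<in> C" using assms(3) by (rule someI)
  then show ?thesis
    using const_off_holes[OF assms(1,2)] assms(3) unfolding constant_on_def coset_value_def by metis
qed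

lemma transversal_exists:
  "\<exists>T. T \<subseteq> carrier G \<and> finite T \<and> bij_betw (\<lambda>t. K M #> t) T (V M)"
proof -
  define r where "r C = (SOME u. u \<in> C)" for C :: "'a set"
  have r: "r C \<in> C" if "C \<in> V M" for C
    unfolding r_def using coset_nonempty[OF that] by (rule someI_ex)
  have rep: "K M #> r C = C" if "C \<in> V M" for C
    using coset_rep[OF that r[OF that]] by simp
  have "bij_betw (\<lambda>t. K M #> t) (r ` V M) (V M)"
    by (rule bij_betwI[of _ _ _ r]) (auto simp: rep)
  moreover have "r ` V M \<subseteq> carrier G" using r coset_mem_carrier by blast
  ultimately show ?thesis using finite_rcosets by blast
qed

text \<open>A pattern on \<open>T\<close> is read off from a translate of \<open>x\<close>. The translation determines, through a coset of
  \<open>K M\<close>, which of the positions are holes and the symbols at all others. As \<open>T\<close> is a transversal, each hole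
  of level \<open>M\<close> is met once.\<close>

lemma pattern_count:
  assumes T: "T \<subseteq> carrier G" "finite T" "bij_betw (\<lambda>t. K M #> t) T (V M)"
  shows "finite ((\<lambda>y. restrict y T) ` topspace X)"
    and "card ((\<lambda>y. restrict y T) ` topspace X) \<le> index M * k ^ card (\<D> M)"
proof -
  define S where "S C t = (if C #> t \<in> \<D> M then {1..k} else {coset_value (C #> t)})" for C t
  have sub: "(\<lambda>y. restrict y T) ` topspace X \<subseteq> (\<Union>C\<in>V M. PiE T (S C))"
  proof
    fix p assume "p \<in> (\<lambda>y. restrict y T) ` topspace X"
    then obtain y where y: "y \<in> topspace X" "p = restrict y T" by blast
    then obtain g where g: "g \<in> carrier G" "\<forall>t\<in>T. y t = x (inv g \<otimes> t)"
      using T(1,2) unfolding mem_orbit_closure by blast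
    define C where "C = K M #> inv g"
    have C: "C \<in> V M" unfolding C_def using g by (intro cosetI) simp
    have "y t \<in> S C t" if t: "t \<in> T" for t
    proof -
      have tc: "t \<in> carrier G" using t T(1) by blast
      have eq: "C #> t = K M #> (inv g \<otimes> t)" unfolding C_def using g tc by (intro coset_mult) auto
      have "inv g \<otimes> t \<in> C #> t" unfolding eq using g tc by (intro coset_self) simp
      then show ?thesis
        using coset_value[OF coset_mult_mem[OF C tc]] g(2) t symbol_mem[OF y(1) tc]
        by (simp add: S_def)
    qed
    then have "p \<in> PiE T (S C)" using y by auto
    then show "p \<in> (\<Union>C\<in>V M. PiE T (S C))" using C by blast
  qed
  have fin: "finite (PiE T (S C))" for C
    using T(2) by (intro finite_PiE) (auto simp: S_def)
  have card_le: "card (PiE T (S C)) \<le> k ^ card (\<D> M)" if C: "C \<in> V M" for C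
  proof -
    let ?J = "{t \<in> T. C #> t \<in> \<D> M}"
    have "card (PiE T (S C)) = (\<Prod>t\<in>T. if C #> t \<in> \<D> M then k else 1)"
      using T(2) by (simp add: card_PiE S_def if_distrib cong: if_cong)
    also have "\<dots> = k ^ card ?J"
      using T(2) by (simp add: prod.If_cases Int_def)
    also have "\<dots> \<le> k ^ card (\<D> M)"
    proof (rule power_increasing[OF _ k_pos])
      show "card ?J \<le> card (\<D> M)"
      proof (rule card_inj_on_le[of "\<lambda>t. C #> t"])
        show "inj_on (\<lambda>t. C #> t) ?J"
        proof (rule inj_onI)
          fix t t' assume t: "t \<in> ?J" "t' \<in> ?J" "C #> t = C #> t'"
          then have tc: "t \<in> carrier G" "t' \<in> carrier G" using T(1) by auto
          have "K M #> t = K M #> t'"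
            using t(3) coset_mult_eq_iff[OF C tc] coset_mult_eq_iff[OF K_coset tc] by blast
          then show "t = t'" using bij_betw_imp_inj_on[OF T(3)] t(1,2) by (auto dest: inj_onD)
        qed
      qed (use finite_holes in auto)
    qed
    finally show ?thesis .
  qed
  have fin_union: "finite (\<Union>C\<in>V M. PiE T (S C))" using finite_rcosets fin by blast
  show "finite ((\<lambda>y. restrict y T) ` topspace X)" by (rule finite_subset[OF sub fin_union])
  have "card ((\<lambda>y. restrict y T) ` topspace X) \<le> card (\<Union>C\<in>V M. PiE T (S C))"
    by (rule card_mono[OF fin_union sub])
  also have "\<dots> \<le> (\<Sum>C\<in>V M. card (PiE T (S C)))" by (rule card_UN_le[OF finite_rcosets])
  also have "\<dots> \<le> (\<Sum>C\<in>V M. k ^ card (\<D> M))" by (rule sum_mono) (rule card_le)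
  also have "\<dots> = index M * k ^ card (\<D> M)" by (simp add: card_V)
  finally show "card ((\<lambda>y. restrict y T) ` topspace X) \<le> index M * k ^ card (\<D> M)" .
qed

text \<open>The coset of \<open>g\<close> lies in the tile of \<open>h\<close>, where \<open>g = h \<otimes> t\<close> with \<open>h\<close> in \<open>K M\<close> and \<open>t\<close> in \<open>T\<close>.\<close>

lemma tiling:
  assumes "M \<le> n" "T \<subseteq> carrier G" "bij_betw (\<lambda>t. K M #> t) T (V M)" "v \<in> V n"
  shows "\<exists>w\<in>subcosets n (K M). \<exists>t\<in>T. v = w #> t"
proof -
  obtain g where g: "g \<in> carrier G" "v = K n #> g" using assms(4) coset_exists_rep by blast
  obtain t where t: "t \<in> T" "K M #> g = K M #> t"
    using bij_betw_imp_surj_on[OF assms(3)] cosetI[OF g(1), of M] by (metis image_iff)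
  have tc: "t \<in> carrier G" using t assms(2) by blast
  have "g \<in> K M #> t" using coset_self[OF g(1)] t(2) by blast
  then obtain h where h: "h \<in> K M" "g = h \<otimes> t" by (rule mem_cosetE)
  have "K n #> h \<in> subcosets n (K M)" by (rule coset_refine[OF assms(1) K_coset h(1)])
  moreover have "v = (K n #> h) #> t" using g h tc by (simp add: coset_mult)
  ultimately show ?thesis using t(1) by blast
qed

section \<open>The upper bound\<close>

text \<open>The vertices at which \<open>\<phi>\<close> fails to be equivariant as far as symbols in the window \<open>U\<close> can tell.\<close>

definition bad_vertices :: "'a set \<Rightarrow> nat \<Rightarrow> ('a set \<Rightarrow> 'a \<Rightarrow> nat) \<Rightarrow> 'a set set" where
  "bad_vertices U n \<phi> = {v \<in> V n. \<exists>f\<in>U. \<phi> (v #> f) \<one> \<noteq> \<phi> v f}"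

context
  fixes d :: "('a \<Rightarrow> nat) \<Rightarrow> ('a \<Rightarrow> nat) \<Rightarrow> real"
  assumes gen: "generating_pseudometric G X (shift G) d"
begin

text \<open>A disagreement of symbols at \<open>v\<close> and \<open>f\<close> forces the points \<open>\<phi> (v #> f)\<close> and \<open>shift G (inv f) (\<phi> v)\<close> to be
  far apart after translation by some \<open>t\<close> in a finite set. By the triangle inequality \<open>\<phi>\<close> is then far
  from being equivariant, either for \<open>t\<close> at \<open>v #> f\<close> or for \<open>t \<otimes> inv f\<close> at \<open>v\<close>, and Markov's inequality
  bounds the number of such vertices.\<close>

lemma few_bad_vertices:
  assumes U: "finite U" "U \<subseteq> carrier G" and \<beta>: "\<beta> > 0"
  shows "\<exists>F \<delta>. finite F \<and> F \<subseteq> carrier G \<and> \<delta> > 0 \<and>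
     (\<forall>n. \<forall>\<phi>\<in>Map_space X (shift G) d F \<delta> (V n) (act n).
        real (card (bad_vertices U n \<phi>)) \<le> \<beta> * real (index n))"
proof -
  obtain S \<kappa> where S: "finite S" "S \<subseteq> carrier G" and \<kappa>: "\<kappa> > 0"
    and sep: "\<And>y z. \<lbrakk>y \<in> topspace X; z \<in> topspace X; y \<one> \<noteq> z \<one>\<rbrakk> \<Longrightarrow>
       \<exists>t\<in>S. d (shift G t y) (shift G t z) > \<kappa>"
    using separated_if_differ[OF gen] by blast
  define F where "F = S \<union> (\<lambda>(t, f). t \<otimes> inv f) ` (S \<times> U)"
  define m where "m = real (card (S \<times> U))"
  \<comment> \<open>Each of the \<open>m\<close> pairs contributes at most \<open>2 * (2 * \<delta> / \<kappa>)\<^sup>2\<close>, and \<open>8 * m * (\<delta> / \<kappa>)\<^sup>2 \<le> \<beta>\<close>.\<close>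
  define \<delta> where "\<delta> = \<kappa> * sqrt (\<beta> / (8 * (m + 1)))"
  have m0: "m \<ge> 0" by (simp add: m_def)
  have "finite F" "F \<subseteq> carrier G" using S U by (auto simp: F_def)
  moreover have "\<delta> > 0" using \<kappa> \<beta> m0 by (simp add: \<delta>_def)
  moreover have "real (card (bad_vertices U n \<phi>)) \<le> \<beta> * real (index n)"
    if \<phi>: "\<phi> \<in> Map_space X (shift G) d F \<delta> (V n) (act n)" for n \<phi>
  proof -
    have \<phi>X: "\<phi> v \<in> topspace X" if "v \<in> V n" for v
      using \<phi> that by (auto simp: Map_space_def)
    define A where "A s = {v \<in> V n. d (\<phi> (act n s v)) (shift G s (\<phi> v)) > \<kappa> / 2}" for s
    have card_A: "real (card (A s)) \<le> (2 * \<delta> / \<kappa>)\<^sup>2 * real (index n)" if "s \<in> F" for s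
    proof -
      have "dist2 d (V n) (\<lambda>v. \<phi> (act n s v)) (\<lambda>v. shift G s (\<phi> v)) \<le> \<delta>"
        using \<phi> that by (auto simp: Map_space_def)
      from dist2_markov[OF finite_rcosets _ this, of "\<kappa> / 2"] show ?thesis
        using \<kappa> by (simp add: A_def card_V mult.commute)
    qed
    define A' where "A' t f = {v \<in> V n. act n (inv f) v \<in> A t}" for t f
    have card_A': "card (A' t f) \<le> card (A t)" if "f \<in> U" for t f
    proof (rule card_inj_on_le[of "act n (inv f)"])
      have "inv f \<in> carrier G" using that U by auto
      then have "inj_on (act n (inv f)) (V n)"
        using bij_coset_action bij_betw_imp_inj_on by blast
      then show "inj_on (act n (inv f)) (A' t f)"
        by (rule inj_on_subset) (auto simp: A'_def)
      show "finite (A t)" using finite_rcosets by (simp add: A_def)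
    qed (auto simp: A'_def)
    have sub: "bad_vertices U n \<phi> \<subseteq> (\<Union>(t, f)\<in>S \<times> U. A' t f \<union> A (t \<otimes> inv f))"
    proof
      fix v assume "v \<in> bad_vertices U n \<phi>"
      then obtain f where v: "v \<in> V n" and f: "f \<in> U" "\<phi> (v #> f) \<one> \<noteq> \<phi> v f"
        by (auto simp: bad_vertices_def)
      have fc: "f \<in> carrier G" "inv f \<in> carrier G" using f U by auto
      let ?w = "act n (inv f) v"
      have w: "?w \<in> V n" "?w = v #> f"
        using v fc by (simp_all add: coset_action_eq coset_mult_mem)
      have "\<phi> ?w \<one> \<noteq> shift G (inv f) (\<phi> v) \<one>"
        unfolding w(2) shift_inv_at_one[OF fc(1)] by (rule f(2))
      then obtain t where t: "t \<in> S"
        "d (shift G t (\<phi> ?w)) (shift G t (shift G (inv f) (\<phi> v))) > \<kappa>"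
        using sep[OF \<phi>X[OF w(1)] shift_closed[OF \<phi>X[OF v] fc(2)]] by blast
      have tc: "t \<in> carrier G" using t S by blast
      have X1: "shift G t (\<phi> ?w) \<in> topspace X" using \<phi>X[OF w(1)] tc by (rule shift_closed)
      have X2: "\<phi> (act n t ?w) \<in> topspace X" by (rule \<phi>X[OF coset_action_mem[OF w(1) tc]])
      have X3: "shift G (t \<otimes> inv f) (\<phi> v) \<in> topspace X" using \<phi>X[OF v] tc fc by (intro shift_closed) auto
      have "\<kappa> < d (shift G t (\<phi> ?w)) (shift G (t \<otimes> inv f) (\<phi> v))"
        unfolding shift_mult[OF tc fc(2)] by (rule t(2))
      also have "\<dots> \<le> d (shift G t (\<phi> ?w)) (\<phi> (act n t ?w)) + d (\<phi> (act n t ?w)) (shift G (t \<otimes> inv f) (\<phi> v))"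
        using pseudometric_triangle[OF gen X1 X2 X3] .
      finally have "\<kappa> / 2 < d (\<phi> (act n t ?w)) (shift G t (\<phi> ?w)) \<or>
          \<kappa> / 2 < d (\<phi> (act n (t \<otimes> inv f) v)) (shift G (t \<otimes> inv f) (\<phi> v))"
        unfolding pseudometric(4)[OF gen X1 X2] coset_action_mult[OF v tc fc(2)] by linarith
      then have "v \<in> A' t f \<union> A (t \<otimes> inv f)" using v w(1) by (auto simp: A_def A'_def)
      then show "v \<in> (\<Union>(t, f)\<in>S \<times> U. A' t f \<union> A (t \<otimes> inv f))" using t(1) f(1) by blast
    qed
    have finA: "finite (A s)" "finite (A' t f)" for s t f
      using finite_rcosets by (simp_all add: A_def A'_def)
    have "card (bad_vertices U n \<phi>) \<le> card (\<Union>(t, f)\<in>S \<times> U. A' t f \<union> A (t \<otimes> inv f))"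
      using S(1) U(1) finA by (intro card_mono[OF _ sub]) auto
    also have "\<dots> \<le> (\<Sum>(t, f)\<in>S \<times> U. card (A' t f \<union> A (t \<otimes> inv f)))"
      using card_UN_le[of "S \<times> U" "\<lambda>(t, f). A' t f \<union> A (t \<otimes> inv f)"] S(1) U(1)
      by (simp add: case_prod_beta)
    finally have "real (card (bad_vertices U n \<phi>))
        \<le> (\<Sum>p\<in>S \<times> U. real (card (A' (fst p) (snd p) \<union> A (fst p \<otimes> inv (snd p)))))"
      by (simp add: case_prod_beta flip: of_nat_sum)
    also have "\<dots> \<le> (\<Sum>p\<in>S \<times> U. 2 * ((2 * \<delta> / \<kappa>)\<^sup>2 * real (index n)))"
    proof (rule sum_mono)
      fix p assume p: "p \<in> S \<times> U"
      have "card (A' (fst p) (snd p) \<union> A (fst p \<otimes> inv (snd p)))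
          \<le> card (A (fst p)) + card (A (fst p \<otimes> inv (snd p)))"
        using card_Un_le[of "A' (fst p) (snd p)" "A (fst p \<otimes> inv (snd p))"] card_A'[of "snd p" "fst p"] p
        by (simp add: mem_Times_iff)
      moreover have "real (card (A (fst p))) \<le> (2 * \<delta> / \<kappa>)\<^sup>2 * real (index n)"
        using p by (intro card_A) (auto simp: F_def)
      moreover have "real (card (A (fst p \<otimes> inv (snd p)))) \<le> (2 * \<delta> / \<kappa>)\<^sup>2 * real (index n)"
        using p by (intro card_A) (force simp: F_def)
      ultimately show "real (card (A' (fst p) (snd p) \<union> A (fst p \<otimes> inv (snd p))))
          \<le> 2 * ((2 * \<delta> / \<kappa>)\<^sup>2 * real (index n))" by linarith
    qed
    also have "\<dots> = m * 8 * (\<delta> / \<kappa>)\<^sup>2 * real (index n)"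
      by (simp add: m_def power_mult_distrib power_divide)
    also have "(\<delta> / \<kappa>)\<^sup>2 = \<beta> / (8 * (m + 1))"
      using \<kappa> \<beta> m0 by (simp add: \<delta>_def)
    also have "m * 8 * (\<beta> / (8 * (m + 1))) * real (index n) \<le> \<beta> * real (index n)"
    proof (rule mult_right_mono)
      show "m * 8 * (\<beta> / (8 * (m + 1))) \<le> \<beta>" using m0 \<beta> by (simp add: field_simps)
    qed simp
    finally show ?thesis .
  qed
  ultimately show ?thesis by blast
qed

text \<open>A map \<open>\<phi>\<close> whose bad set is \<open>B\<close> is determined up to \<open>\<epsilon>\<close> by two pieces of data: its symbols on each
  tile, which form a pattern of the orbit closure when the base point of the tile is good, and
  its \<open>E\<close>-patterns at the vertices of \<open>B\<close>. At a good vertex the \<open>E\<close>-pattern can be read off from the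
  symbols.\<close>

lemma coded_family_bound:
  assumes Mn: "M \<le> n"
    and T: "T \<subseteq> carrier G" "finite T" "bij_betw (\<lambda>t. K M #> t) T (V M)"
    and E: "E \<subseteq> carrier G" "finite E"
      "\<And>y z. \<lbrakk>y \<in> topspace X; z \<in> topspace X; \<forall>e\<in>E. y e = z e\<rbrakk> \<Longrightarrow> d y z < \<epsilon>"
    and A: "A \<subseteq> V n \<rightarrow>\<^sub>E topspace X" "separated_set \<epsilon> (dist_inf d (V n)) A"
    and bad: "\<And>\<phi>. \<phi> \<in> A \<Longrightarrow> bad_vertices (T \<union> E) n \<phi> = B"
    and B: "B \<subseteq> V n"
  shows "card A \<le> (index M * k ^ card (\<D> M)) ^ ratio M n * k ^ ((card T + card E) * card B)"
proof -
  define W where "W = subcosets n (K M)"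
  have W: "W \<subseteq> V n" by (auto simp: W_def subcosets_def)
  define P where "P = (\<lambda>y. restrict y T) ` topspace X"
  define code where "code \<phi> = (\<lambda>v\<in>V n. (if v \<in> W then (\<lambda>t\<in>T. \<phi> (v #> t) \<one>) else undefined,
     if v \<in> B then restrict (\<phi> v) E else undefined))" for \<phi> :: "'a set \<Rightarrow> 'a \<Rightarrow> nat"
  define S1 where "S1 v = (if v \<in> W then if v \<in> B then PiE T (\<lambda>_. {1..k}) else P else {undefined})" for v
  define S2 where "S2 v = (if v \<in> B then PiE E (\<lambda>_. {1..k}) else {undefined})" for v
  have \<phi>X: "\<phi> v \<in> topspace X" if "\<phi> \<in> A" "v \<in> V n" for \<phi> v
    using A(1) that by auto
  have finP: "finite P" unfolding P_def by (rule pattern_count(1)[OF T])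
  have fin: "finite (S1 v \<times> S2 v)" for v
    using finP T(2) E(2) by (auto simp: S1_def S2_def intro!: finite_PiE)
  have good: "\<phi> (v #> f) \<one> = \<phi> v f" if "\<phi> \<in> A" "v \<in> V n" "v \<notin> B" "f \<in> T \<union> E" for \<phi> v f
    using bad[OF that(1)] that(2-4) unfolding bad_vertices_def by blast
  have range: "code ` A \<subseteq> PiE (V n) (\<lambda>v. S1 v \<times> S2 v)"
  proof
    fix c assume "c \<in> code ` A"
    then obtain \<phi> where \<phi>: "\<phi> \<in> A" "c = code \<phi>" by blast
    have mem: "\<phi> v f \<in> {1..k}" if "v \<in> V n" "f \<in> carrier G" for v f
      using symbol_mem[OF \<phi>X[OF \<phi>(1) that(1)] that(2)] .
    have "(if v \<in> W then (\<lambda>t\<in>T. \<phi> (v #> t) \<one>) else undefined) \<in> S1 v" if v: "v \<in> V n" for v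
    proof (cases "v \<in> W \<and> v \<notin> B")
      case True
      then have "(\<lambda>t\<in>T. \<phi> (v #> t) \<one>) = restrict (\<phi> v) T"
        using good[OF \<phi>(1) v] by (intro restrict_ext) auto
      then show ?thesis using True \<phi>X[OF \<phi>(1) v] by (simp add: S1_def P_def)
    next
      case False
      have "\<phi> (v #> t) \<one> \<in> {1..k}" if "t \<in> T" for t
        using that T(1) v by (intro mem coset_mult_mem) auto
      then show ?thesis using False by (auto simp: S1_def)
    qed
    moreover have "(if v \<in> B then restrict (\<phi> v) E else undefined) \<in> S2 v" if v: "v \<in> V n" for v
      using mem[OF v] E(1) by (auto simp: S2_def)
    ultimately show "c \<in> PiE (V n) (\<lambda>v. S1 v \<times> S2 v)" by (auto simp: \<phi>(2) code_def)
  qed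
  have inj: "inj_on code A"
  proof (rule inj_onI, rule ccontr)
    fix \<phi> \<psi> assume \<phi>: "\<phi> \<in> A" and \<psi>: "\<psi> \<in> A" and eq: "code \<phi> = code \<psi>" and neq: "\<phi> \<noteq> \<psi>"
    have eq_at: "code \<phi> v = code \<psi> v" for v using eq by simp
    have letter: "\<phi> v \<one> = \<psi> v \<one>" if v: "v \<in> V n" for v
    proof -
      obtain w t where wt: "w \<in> W" "t \<in> T" "v = w #> t"
        using tiling[OF Mn T(1,3) v] by (auto simp: W_def)
      have "(\<lambda>t\<in>T. \<phi> (w #> t) \<one>) = (\<lambda>t\<in>T. \<psi> (w #> t) \<one>)"
        using eq_at[of w] wt(1) W by (simp add: code_def subset_iff)
      then show ?thesis using wt(2,3) by (metis restrict_apply')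
    qed
    have "d (\<phi> v) (\<psi> v) < \<epsilon>" if v: "v \<in> V n" for v
    proof (rule E(3)[OF \<phi>X[OF \<phi> v] \<phi>X[OF \<psi> v]], rule ballI)
      fix e assume e: "e \<in> E"
      show "\<phi> v e = \<psi> v e"
      proof (cases "v \<in> B")
        case True
        then have "restrict (\<phi> v) E = restrict (\<psi> v) E"
          using eq_at[of v] v by (simp add: code_def)
        then show ?thesis using e by (metis restrict_apply')
      next
        case False
        have "v #> e \<in> V n" using v e E(1) by (intro coset_mult_mem) auto
        then show ?thesis using good[OF \<phi> v False] good[OF \<psi> v False] e letter by (metis UnCI)
      qed
    qed
    then have "dist_inf d (V n) \<phi> \<psi> < \<epsilon>"
      unfolding dist_inf_def using finite_rcosets V_nonempty by simp
    moreover have "dist_inf d (V n) \<phi> \<psi> > \<epsilon>"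
      using A(2) \<phi> \<psi> neq by (simp add: separated_set_def)
    ultimately show False by simp
  qed
  define Q where "Q = index M * k ^ card (\<D> M)"
  have Q: "Q \<ge> 1" using index_pos[of M] k_pos by (simp add: Q_def Suc_leI)
  have "card A \<le> card (PiE (V n) (\<lambda>v. S1 v \<times> S2 v))"
    using fin finite_rcosets by (intro card_inj_on_le[OF inj range] finite_PiE) auto
  also have "\<dots> = (\<Prod>v\<in>V n. card (S1 v \<times> S2 v))" by (rule card_PiE[OF finite_rcosets])
  also have "\<dots> \<le> (\<Prod>v\<in>V n. (if v \<in> W then Q else 1) * (if v \<in> B then k ^ (card T + card E) else 1))"
  proof (rule prod_mono, rule conjI)
    fix v assume "v \<in> V n"
    have P: "card P \<le> Q" unfolding P_def Q_def by (rule pattern_count(2)[OF T])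
    have kT: "1 \<le> k ^ card T" using k_pos by simp
    show "card (S1 v \<times> S2 v) \<le> (if v \<in> W then Q else 1) * (if v \<in> B then k ^ (card T + card E) else 1)"
      using P Q kT T(2) E(2) mult_right_mono[OF kT, of "k ^ card E"]
        mult_right_mono[OF Q, of "k ^ card T * k ^ card E"]
      by (simp add: S1_def S2_def card_PiE card_cartesian_product power_add)
  qed simp
  also have "\<dots> = Q ^ card W * (k ^ (card T + card E)) ^ card B"
    using finite_rcosets W B by (simp add: prod.distrib prod.If_cases Int_absorb1)
  finally show ?thesis by (simp add: Q_def W_def power_mult)
qed

end

end

context toeplitz_array
begin

context
  fixes d :: "('a \<Rightarrow> nat) \<Rightarrow> ('a \<Rightarrow> nat) \<Rightarrow> real"
  assumes gen: "generating_pseudometric G X (shift G) d"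
begin

text \<open>The previous bound is summed over all possible bad sets, which are small and hence few.\<close>

lemma separated_family_bound:
  fixes \<beta> t :: real
  assumes Mn: "M \<le> n"
    and T: "T \<subseteq> carrier G" "finite T" "bij_betw (\<lambda>t. K M #> t) T (V M)"
    and E: "E \<subseteq> carrier G" "finite E"
      "\<And>y z. \<lbrakk>y \<in> topspace X; z \<in> topspace X; \<forall>e\<in>E. y e = z e\<rbrakk> \<Longrightarrow> d y z < \<epsilon>"
    and A: "A \<subseteq> V n \<rightarrow>\<^sub>E topspace X" "separated_set \<epsilon> (dist_inf d (V n)) A"
    and few: "\<And>\<phi>. \<phi> \<in> A \<Longrightarrow> real (card (bad_vertices (T \<union> E) n \<phi>)) \<le> \<beta> * real (index n)"
    and t: "0 < t" "t \<le> 1"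
  shows "real (card A) \<le> exp (real (index n) * (\<beta> * ln (1 / t) + t
     + ln (real (index M)) / real (index M) + real (card (\<D> M)) / real (index M) * ln (real k)
     + \<beta> * (real (card T + card E) * ln (real k))))"
proof -
  define N where "N = real (index n)"
  define I where "I = real (index M)"
  define c where "c = card T + card E"
  define Q where "Q = index M * k ^ card (\<D> M)"
  define \<B> where "\<B> = {B. B \<subseteq> V n \<and> real (card B) \<le> \<beta> * real (card (V n))}"
  have I: "I > 0" using index_pos by (simp add: I_def)
  have lnk: "ln (real k) \<ge> 0" using k_pos by simp
  have fin\<B>: "finite \<B>" unfolding \<B>_def by (rule finite_subset[of _ "Pow (V n)"]) (use finite_rcosets in auto)
  have finA: "finite A" using A(2) by (simp add: separated_set_def)
  define AB where "AB B = {\<phi> \<in> A. bad_vertices (T \<union> E) n \<phi> = B}" for B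
  have cover: "A \<subseteq> (\<Union>B\<in>\<B>. AB B)"
  proof
    fix \<phi> assume \<phi>: "\<phi> \<in> A"
    have "bad_vertices (T \<union> E) n \<phi> \<in> \<B>"
      using few[OF \<phi>] by (auto simp: \<B>_def card_V bad_vertices_def)
    then show "\<phi> \<in> (\<Union>B\<in>\<B>. AB B)" using \<phi> by (auto simp: AB_def)
  qed
  have ratio: "real (ratio M n) = N / I"
    using index_mult[OF Mn] I by (simp add: N_def I_def)
  have lnQ: "ln (real Q) = ln I + real (card (\<D> M)) * ln (real k)"
    using I k_pos by (simp add: Q_def I_def ln_mult ln_realpow)
  have Qpos: "real Q > 0" using I k_pos by (simp add: Q_def I_def)
  have AB_le: "real (card (AB B)) \<le> exp (N / I * ln (real Q) + \<beta> * N * (real c * ln (real k)))"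
    if B: "B \<in> \<B>" for B
  proof -
    have "card (AB B) \<le> Q ^ ratio M n * k ^ (c * card B)"
      unfolding Q_def c_def
    proof (rule coded_family_bound[OF gen Mn T E])
      show "separated_set \<epsilon> (dist_inf d (V n)) (AB B)"
        using A(2) by (auto simp: separated_set_def AB_def)
    qed (use A(1) B in \<open>auto simp: AB_def \<B>_def\<close>)
    then have "real (card (AB B)) \<le> real Q ^ ratio M n * real k ^ (c * card B)"
      by (metis of_nat_le_iff of_nat_mult of_nat_power)
    also have "real Q ^ ratio M n = exp (N / I * ln (real Q))"
      using Qpos by (simp add: ratio[symmetric] exp_of_nat_mult)
    also have "real k ^ (c * card B) = exp (real (c * card B) * ln (real k))"
      using k_pos exp_of_nat_mult[of "c * card B" "ln (real k)"] by simp
    also have "\<dots> \<le> exp (\<beta> * N * (real c * ln (real k)))"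
    proof -
      have "real (card B) * (real c * ln (real k)) \<le> \<beta> * N * (real c * ln (real k))"
        using B lnk by (intro mult_right_mono) (auto simp: \<B>_def N_def card_V)
      then show ?thesis by (simp add: mult.commute mult.left_commute)
    qed
    finally show ?thesis by (simp add: exp_add)
  qed
  have "card A \<le> card (\<Union>B\<in>\<B>. AB B)"
    using finA fin\<B> by (intro card_mono[OF _ cover]) (auto simp: AB_def)
  also have "\<dots> \<le> (\<Sum>B\<in>\<B>. card (AB B))" by (rule card_UN_le[OF fin\<B>])
  finally have "real (card A) \<le> (\<Sum>B\<in>\<B>. real (card (AB B)))" by (simp flip: of_nat_sum)
  also have "\<dots> \<le> (\<Sum>B\<in>\<B>. exp (N / I * ln (real Q) + \<beta> * N * (real c * ln (real k))))"
    by (rule sum_mono) (rule AB_le)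
  also have "\<dots> = real (card \<B>) * exp (N / I * ln (real Q) + \<beta> * N * (real c * ln (real k)))" by simp
  also have "\<dots> \<le> exp (N * (\<beta> * ln (1 / t) + t)) * exp (N / I * ln (real Q) + \<beta> * N * (real c * ln (real k)))"
    using card_small_subsets[OF finite_rcosets[of n] t, of \<beta>]
    by (intro mult_right_mono) (auto simp: \<B>_def N_def card_V)
  also have "\<dots> = exp (N * (\<beta> * ln (1 / t) + t + ln I / I + real (card (\<D> M)) / I * ln (real k)
      + \<beta> * (real c * ln (real k))))"
    using I by (simp add: lnQ field_simps flip: exp_add)
  finally show ?thesis by (simp add: N_def I_def c_def)
qed

theorem entropy_upper_bound:
  "sofic_entropy_wrt G V act X (shift G) d \<le> ereal (\<theta> * ln (real k))"
proof (rule ereal_le_epsilon2)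
  fix \<eta> :: real assume \<eta>: "\<eta> > 0"
  have lnk: "ln (real k) \<ge> 0" using k_pos by simp
  have "(\<lambda>M. ln (real (index M)) / real (index M) + real (card (\<D> M)) / real (index M) * ln (real k))
      \<longlonglongrightarrow> 0 + \<theta> * ln (real k)"
    by (intro tendsto_add tendsto_mult hole_density tendsto_const
        filterlim_compose[OF ln_x_over_x_tendsto_0 filterlim_index])
  then have "\<forall>\<^sub>F M in sequentially. ln (real (index M)) / real (index M)
      + real (card (\<D> M)) / real (index M) * ln (real k) < \<theta> * ln (real k) + \<eta> / 2"
    using \<eta> by (intro order_tendstoD(2)) auto
  then obtain M where M: "ln (real (index M)) / real (index M)
      + real (card (\<D> M)) / real (index M) * ln (real k) < \<theta> * ln (real k) + \<eta> / 2"
    by (auto simp: eventually_sequentially)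
  obtain T where T: "T \<subseteq> carrier G" "finite T" "bij_betw (\<lambda>t. K M #> t) T (V M)"
    using transversal_exists by blast
  show "sofic_entropy_wrt G V act X (shift G) d \<le> ereal (\<theta> * ln (real k)) + ereal \<eta>"
    unfolding sofic_entropy_wrt_def
  proof (rule SUP_least)
    fix \<epsilon> :: real assume "\<epsilon> \<in> {0<..}"
    then obtain E where E: "finite E" "E \<subseteq> carrier G"
      and agree: "\<And>y z. \<lbrakk>y \<in> topspace X; z \<in> topspace X; \<forall>e\<in>E. y e = z e\<rbrakk> \<Longrightarrow> d y z < \<epsilon>"
      using close_if_agree[OF gen] by (metis greaterThan_iff)
    define t where "t = min 1 (\<eta> / 4)"
    have t: "0 < t" "t \<le> 1" "t \<le> \<eta> / 4" using \<eta> by (auto simp: t_def)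
    define c where "c = ln (1 / t) + real (card T + card E) * ln (real k)"
    have c: "c \<ge> 0" using t lnk by (simp add: c_def)
    \<comment> \<open>The error is \<open>\<beta> * c + t\<close>, so \<open>t\<close> is fixed first and \<open>\<beta>\<close> is small relative to \<open>ln (1 / t)\<close>.\<close>
    define \<beta> where "\<beta> = \<eta> / (4 * (c + 1))"
    have \<beta>: "\<beta> > 0" "\<beta> * c \<le> \<eta> / 4" using \<eta> c by (simp_all add: \<beta>_def field_simps)
    have "finite (T \<union> E)" "T \<union> E \<subseteq> carrier G" using T E by auto
    from few_bad_vertices[OF gen this \<beta>(1)] obtain F \<delta> where F: "finite F" "F \<subseteq> carrier G" and \<delta>: "\<delta> > 0"
      and few: "\<And>n \<phi>. \<phi> \<in> Map_space X (shift G) d F \<delta> (V n) (act n) \<Longrightarrow>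
        real (card (bad_vertices (T \<union> E) n \<phi>)) \<le> \<beta> * real (index n)"
      by blast
    have "\<forall>\<^sub>F n in sequentially. ereal (1 / real (card (V n))) * log_card
        (sep_number \<epsilon> (Map_space X (shift G) d F \<delta> (V n) (act n)) (dist_inf d (V n)))
        \<le> ereal (\<theta> * ln (real k)) + ereal \<eta>"
      using eventually_ge_at_top[of M]
    proof eventually_elim
      case (elim n)
      have "log_card (sep_number \<epsilon> (Map_space X (shift G) d F \<delta> (V n) (act n)) (dist_inf d (V n)))
          \<le> ereal (real (index n) * (\<theta> * ln (real k) + \<eta>))"
      proof (rule log_card_sep_number_le)
        fix A assume A: "A \<subseteq> Map_space X (shift G) d F \<delta> (V n) (act n)"
          "separated_set \<epsilon> (dist_inf d (V n)) A"
        have A': "A \<subseteq> V n \<rightarrow>\<^sub>E topspace X" using A(1) by (auto simp: Map_space_def)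
        have "real (card A) \<le> exp (real (index n) * (\<beta> * ln (1 / t) + t
           + ln (real (index M)) / real (index M) + real (card (\<D> M)) / real (index M) * ln (real k)
           + \<beta> * (real (card T + card E) * ln (real k))))"
          by (rule separated_family_bound[OF elim T E(2,1) agree A' A(2) few t(1,2)]) (use A(1) in blast)+
        also have "\<dots> \<le> exp (real (index n) * (\<theta> * ln (real k) + \<eta>))"
        proof -
          have "\<beta> * ln (1 / t) + \<beta> * (real (card T + card E) * ln (real k)) \<le> \<eta> / 4"
            using \<beta>(2) by (simp add: c_def algebra_simps)
          then show ?thesis using M t(3) by (intro exp_le_cancel_iff[THEN iffD2] mult_left_mono) auto
        qed
        finally show "real (card A) \<le> exp (real (index n) * (\<theta> * ln (real k) + \<eta>))" .
      qed
      then have "ereal (1 / real (card (V n))) * log_card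
          (sep_number \<epsilon> (Map_space X (shift G) d F \<delta> (V n) (act n)) (dist_inf d (V n)))
          \<le> ereal (1 / real (index n)) * ereal (real (index n) * (\<theta> * ln (real k) + \<eta>))"
        unfolding card_V by (intro ereal_mult_left_mono) auto
      also have "\<dots> = ereal (\<theta> * ln (real k)) + ereal \<eta>" using index_pos[of n] by simp
      finally show ?case .
    qed
    then have "limsup (\<lambda>n. ereal (1 / real (card (V n))) * log_card
        (sep_number \<epsilon> (Map_space X (shift G) d F \<delta> (V n) (act n)) (dist_inf d (V n))))
        \<le> ereal (\<theta> * ln (real k)) + ereal \<eta>"
      by (rule Limsup_bounded)
    then show "(INF F \<in> {F. F \<subseteq> carrier G \<and> finite F}. INF \<delta> \<in> {0<..}.
        limsup (\<lambda>n. ereal (1 / real (card (V n))) * log_card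
          (sep_number \<epsilon> (Map_space X (shift G) d F \<delta> (V n) (act n)) (dist_inf d (V n)))))
        \<le> ereal (\<theta> * ln (real k)) + ereal \<eta>"
      using F \<delta> by (intro INF_lower2[of F] INF_lower2[of \<delta>]) auto
  qed
qed

end

section \<open>Windows whose holes can be filled freely\<close>

text \<open>At these vertices a pattern on the holes in the window \<open>W\<close> may fail to be a request, because no
  placement of the window keeps all of these holes open down to level \<open>M\<close>.\<close>

definition blocked_windows_at :: "nat \<Rightarrow> 'a set \<Rightarrow> nat \<Rightarrow> 'a set set" where
  "blocked_windows_at n W M = {C \<in> V n. \<forall>u\<in>C. \<exists>f\<in>W. u \<otimes> f \<in> D n - D M}"

definition blocked_windows :: "nat \<Rightarrow> 'a set \<Rightarrow> 'a set set" where
  "blocked_windows n W = (\<Union>M\<in>{n..}. blocked_windows_at n W M)"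

lemma blocked_windows_subset: "blocked_windows n W \<subseteq> V n"
  by (auto simp: blocked_windows_def blocked_windows_at_def)

lemma holes_refine: "n \<le> M \<Longrightarrow> \<D> M \<subseteq> subcosets M (D n)"
  using D_antimono[of n M] holes_rcosets[of M] by (auto simp: subcosets_def)

text \<open>A blocked vertex is blocked at each of the \<open>ratio n M\<close> cosets of \<open>K M\<close> that it contains, and each of
  these, translated by some \<open>f\<close> in \<open>W\<close>, lies in \<open>D n - D M\<close>. There are \<open>card (\<D> n) * ratio n M - card (\<D> M)\<close>
  such cosets. The inequality is stated without subtraction.\<close>

lemma card_blocked_windows_at:
  assumes nM: "n \<le> M" and W: "finite W" "W \<subseteq> carrier G"
  shows "card (blocked_windows_at n W M) * ratio n M + card W * card (\<D> M) \<le> card W * (card (\<D> n) * ratio n M)"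
proof -
  define \<G> where "\<G> = subcosets M (D n) - \<D> M"
  have card\<G>: "card \<G> + card (\<D> M) = card (\<D> n) * ratio n M"
    using card_subcosets_Union[OF nM holes_rcosets] holes_refine[OF nM] finite_holes
      card_mono[OF finite_subcosets holes_refine[OF nM]]
    by (simp add: \<G>_def card_Diff_subset)
  have fin\<G>: "finite \<G>" by (simp add: \<G>_def)
  have sub: "subcosets M (\<Union>(blocked_windows_at n W M)) \<subseteq> (\<Union>f\<in>W. {B \<in> V M. B #> f \<in> \<G>})"
  proof
    fix B assume B: "B \<in> subcosets M (\<Union>(blocked_windows_at n W M))"
    then have BV: "B \<in> V M" by (simp add: subcosets_def)
    obtain u where u: "u \<in> B" using coset_nonempty[OF BV] ..
    obtain C where C: "C \<in> blocked_windows_at n W M" "u \<in> C" using B u by (auto simp: subcosets_def)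
    then obtain f where f: "f \<in> W" "u \<otimes> f \<in> D n" "u \<otimes> f \<notin> D M"
      unfolding blocked_windows_at_def by blast
    have c: "u \<in> carrier G" "f \<in> carrier G" using u coset_mem_carrier[OF BV] f W by auto
    have Bf: "B #> f = K M #> (u \<otimes> f)" by (rule coset_mult_rep[OF BV u c(2)])
    have "K M #> (u \<otimes> f) \<subseteq> D n"
      using mem_D_coset[of "u \<otimes> f" _ M n] nM f(2) c by blast
    moreover have "K M #> (u \<otimes> f) \<in> V M" using c by (intro cosetI) simp
    moreover have "K M #> (u \<otimes> f) \<notin> \<D> M" using f(3) c mem_D_iff[of "u \<otimes> f" M] by simp
    ultimately have "B #> f \<in> \<G>" by (simp add: \<G>_def subcosets_def Bf)
    then show "B \<in> (\<Union>f\<in>W. {B \<in> V M. B #> f \<in> \<G>})" using f(1) BV by blast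
  qed
  have "card (blocked_windows_at n W M) * ratio n M = card (subcosets M (\<Union>(blocked_windows_at n W M)))"
    by (rule card_subcosets_Union[OF nM, symmetric]) (auto simp: blocked_windows_at_def)
  also have "\<dots> \<le> card (\<Union>f\<in>W. {B \<in> V M. B #> f \<in> \<G>})"
    using W(1) finite_rcosets by (intro card_mono[OF _ sub]) auto
  also have "\<dots> \<le> (\<Sum>f\<in>W. card {B \<in> V M. B #> f \<in> \<G>})" by (rule card_UN_le[OF W(1)])
  also have "\<dots> \<le> (\<Sum>f\<in>W. card \<G>)"
  proof (rule sum_mono)
    fix f assume "f \<in> W"
    then have "inj_on (\<lambda>B. B #> f) (V M)" using W(2) coset_mult_inj by blast
    then show "card {B \<in> V M. B #> f \<in> \<G>} \<le> card \<G>"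
      by (intro card_inj_on_le[of "\<lambda>B. B #> f"]) (auto intro: inj_on_subset fin\<G>)
  qed
  also have "\<dots> = card W * card \<G>" by simp
  finally show ?thesis by (simp add: card\<G>[symmetric] distrib_left)
qed

lemma hole_density_antimono:
  assumes "n \<le> M"
  shows "real (card (\<D> M)) / real (index M) \<le> real (card (\<D> n)) / real (index n)"
proof -
  have "card (\<D> M) \<le> card (\<D> n) * ratio n M"
    using card_mono[OF finite_subcosets holes_refine[OF assms]]
      card_subcosets_Union[OF assms holes_rcosets] by simp
  then have "real (card (\<D> M)) \<le> real (card (\<D> n)) * real (ratio n M)"
    by (metis of_nat_le_iff of_nat_mult)
  then show ?thesis
    using index_mult[OF assms] index_pos[of n] ratio_pos[OF assms] by (simp add: field_simps)
qed

lemma density_ge: "\<theta> \<le> real (card (\<D> n)) / real (index n)"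
  by (rule LIMSEQ_le_const2[OF hole_density]) (use hole_density_antimono in blast)

text \<open>Being blocked is monotone in \<open>M\<close> and there are finitely many vertices, so a single level \<open>M\<close> already
  blocks all of them. The density of the holes decreases to \<open>\<theta>\<close>, which bounds what is lost between
  \<open>n\<close> and \<open>M\<close>.\<close>

lemma card_blocked_windows:
  assumes W: "finite W" "W \<subseteq> carrier G"
  shows "real (card (blocked_windows n W)) \<le> real (card W) * (real (card (\<D> n)) - \<theta> * real (index n))"
proof -
  have fin: "finite (blocked_windows n W)"
    using blocked_windows_subset finite_rcosets finite_subset by blast
  have "\<forall>C\<in>blocked_windows n W. \<exists>M. n \<le> M \<and> C \<in> blocked_windows_at n W M"
    by (auto simp: blocked_windows_def)
  then obtain m where m: "\<And>C. C \<in> blocked_windows n W \<Longrightarrow> n \<le> m C \<and> C \<in> blocked_windows_at n W (m C)"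
    by metis
  define M where "M = Max (insert n (m ` blocked_windows n W))"
  have nM: "n \<le> M" using fin by (simp add: M_def)
  have "C \<in> blocked_windows_at n W M" if C: "C \<in> blocked_windows n W" for C
  proof -
    have "m C \<le> M" using fin C by (simp add: M_def)
    then have "D M \<subseteq> D (m C)" by (rule D_antimono)
    then show ?thesis using m[OF C] unfolding blocked_windows_at_def by blast
  qed
  then have "card (blocked_windows n W) \<le> card (blocked_windows_at n W M)"
    using finite_rcosets[of n] by (intro card_mono) (auto simp: blocked_windows_at_def)
  then have "card (blocked_windows n W) * ratio n M + card W * card (\<D> M)
      \<le> card W * (card (\<D> n) * ratio n M)"
    using card_blocked_windows_at[OF nM W] by (meson add_le_mono1 mult_le_mono1 order_trans)
  then have le: "real (card (blocked_windows n W)) * real (ratio n M) + real (card W) * real (card (\<D> M))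
      \<le> real (card W) * (real (card (\<D> n)) * real (ratio n M))"
    by (metis of_nat_add of_nat_le_iff of_nat_mult)
  have "\<theta> * real (index n) * real (ratio n M) \<le> real (card (\<D> M))"
    using density_ge[of M] index_mult[OF nM] index_pos[of M] by (simp add: pos_le_divide_eq mult.assoc)
  then have "real (card W) * (\<theta> * real (index n) * real (ratio n M)) \<le> real (card W) * real (card (\<D> M))"
    by (intro mult_left_mono) auto
  then have "real (card (blocked_windows n W)) * real (ratio n M)
      \<le> (real (card W) * (real (card (\<D> n)) - \<theta> * real (index n))) * real (ratio n M)"
    using le by (simp add: algebra_simps)
  then show ?thesis using ratio_pos[OF nM] by simp
qed

text \<open>The holes in the window form a request. The other positions carry the right symbol at every
  element of \<open>C\<close>, since \<open>x\<close> is constant on their cosets.\<close>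

lemma window_realized:
  assumes C: "C \<in> V n" "C \<notin> blocked_windows n W"
    and W: "finite W" "W \<subseteq> carrier G" "inj_on (\<lambda>f. C #> f) W"
    and q: "\<And>B. q B \<in> {1..k}"
  shows "\<exists>u\<in>C. \<forall>f\<in>W. x (u \<otimes> f) = (if C #> f \<in> \<D> n then q (C #> f) else coset_value (C #> f))"
proof -
  obtain g where g: "g \<in> C" using coset_nonempty[OF C(1)] ..
  have gc: "g \<in> carrier G" using coset_mem_carrier[OF C(1) g] .
  have Cg: "C = K n #> g" by (rule coset_rep[OF C(1) g])
  have Wc: "f \<in> carrier G" if "f \<in> W" for f using that W(2) by blast
  have coset_f: "K n #> (u \<otimes> f) = C #> f" if "u \<in> C" "f \<in> W" for u f
    using coset_mult_rep[OF C(1) that(1) Wc[OF that(2)]] by simp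
  obtain fs where fs: "set fs = {f \<in> W. C #> f \<in> \<D> n}"
    using finite_list[of "{f \<in> W. C #> f \<in> \<D> n}"] W(1) by auto
  define ps where "ps = map (\<lambda>f. (g \<otimes> f, q (C #> f))) fs"
  have "(n, ps) \<in> requests k"
    unfolding requests_def mem_Collect_eq prod.case
  proof (intro conjI ballI impI allI)
    show "set ps \<subseteq> D n \<times> {1..k}"
    proof
      fix p assume "p \<in> set ps"
      then obtain f where f: "f \<in> W" "C #> f \<in> \<D> n" "p = (g \<otimes> f, q (C #> f))"
        by (auto simp: ps_def fs)
      have "g \<otimes> f \<in> D n"
        using mem_D_iff[of "g \<otimes> f" n] f(2) coset_f[OF g f(1)] gc Wc[OF f(1)] by simp
      then show "p \<in> D n \<times> {1..k}" unfolding f(3) using q by (rule SigmaI)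
    qed
  next
    fix p p' assume "p \<in> set ps" "p' \<in> set ps" and eq: "K n #> fst p = K n #> fst p'"
    then obtain f f' where f: "f \<in> W" "p = (g \<otimes> f, q (C #> f))" "f' \<in> W" "p' = (g \<otimes> f', q (C #> f'))"
      by (auto simp: ps_def fs)
    then have "C #> f = C #> f'" using eq coset_f[OF g f(1)] coset_f[OF g f(3)] by simp
    then have "f = f'" by (rule inj_onD[OF W(3) _ f(1,3)])
    then show "p = p'" using f by simp
  next
    fix M
    have "C \<notin> blocked_windows_at n W (max n M)"
      using C(2) by (auto simp: blocked_windows_def)
    then have "\<exists>u\<in>C. \<forall>f\<in>W. u \<otimes> f \<notin> D n - D (max n M)"
      using C(1) by (simp add: blocked_windows_at_def)
    then obtain u where u: "u \<in> C" "\<forall>f\<in>W. u \<otimes> f \<notin> D n - D (max n M)" ..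
    obtain h where h: "h \<in> K n" "u = h \<otimes> g" using u(1) unfolding Cg by (rule mem_cosetE)
    have mem: "h \<otimes> fst p \<in> D M" if "p \<in> set ps" for p
    proof -
      obtain f where f: "f \<in> W" "C #> f \<in> \<D> n" "p = (g \<otimes> f, q (C #> f))"
        using \<open>p \<in> set ps\<close> by (auto simp: ps_def fs)
      have uc: "u \<otimes> f \<in> carrier G" using coset_mem_carrier[OF C(1) u(1)] Wc[OF f(1)] by simp
      have "u \<otimes> f \<in> D n" using mem_D_iff[OF uc] coset_f[OF u(1) f(1)] f(2) by simp
      then have "u \<otimes> f \<in> D (max n M)" using u(2) f(1) by blast
      then have "u \<otimes> f \<in> D M" using D_antimono[of M "max n M"] by auto
      then show ?thesis using h gc Wc[OF f(1)] by (simp add: f(3) m_assoc)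
    qed
    show "\<exists>h\<in>K n. \<forall>p\<in>set ps. h \<otimes> fst p \<in> D M"
      by (intro bexI[OF _ h(1)] ballI mem)
  qed
  then have "\<exists>h\<in>K n. \<forall>(u, v)\<in>set ps. x (h \<otimes> u) = v" by (rule requests_realized)
  then obtain h where h: "h \<in> K n" "\<forall>(u, v)\<in>set ps. x (h \<otimes> u) = v" ..
  have u: "h \<otimes> g \<in> C" unfolding Cg by (rule coset_left_mult[OF h(1) gc])
  have "x (h \<otimes> g \<otimes> f) = (if C #> f \<in> \<D> n then q (C #> f) else coset_value (C #> f))" if f: "f \<in> W" for f
  proof (cases "C #> f \<in> \<D> n")
    case True
    then have "(g \<otimes> f, q (C #> f)) \<in> set ps" using f by (auto simp: ps_def fs)
    from bspec[OF h(2) this] have "x (h \<otimes> (g \<otimes> f)) = q (C #> f)" by simp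
    then show ?thesis using True h(1) gc Wc[OF f] by (simp add: m_assoc)
  next
    case False
    have "h \<otimes> g \<otimes> f \<in> C #> f"
      using coset_self[of "h \<otimes> g \<otimes> f" n] coset_f[OF u f] h(1) gc Wc[OF f] by simp
    then show ?thesis
      using coset_value[OF coset_mult_mem[OF C(1) Wc[OF f]] False] False by simp
  qed
  then show ?thesis by (intro bexI[OF _ u] ballI)
qed

section \<open>The lower bound\<close>

context
  fixes d :: "('a \<Rightarrow> nat) \<Rightarrow> ('a \<Rightarrow> nat) \<Rightarrow> real"
  assumes gen: "generating_pseudometric G X (shift G) d"
begin

text \<open>Each filling of the holes \<open>P\<close> gives a colouring \<open>\<psi>\<close> of the vertices and a map \<open>\<phi>\<close> that sends an
  unblocked vertex to a translate of \<open>x\<close> which shows \<open>\<psi>\<close> in the window \<open>W\<close>. The window contains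
  \<open>E\<close> and its translates by \<open>inv s\<close>, so that \<open>\<phi>\<close> at \<open>v\<close> and at \<open>act n s v\<close> can be compared on \<open>E\<close>.
  Two fillings that differ at \<open>C\<close> are separated at \<open>act n t C\<close> for some \<open>t\<close> in \<open>S\<close>. Therefore only
  those holes are varied for which all these vertices are unblocked.\<close>

lemma many_separated_models:
  assumes S: "finite S" "S \<subseteq> carrier G"
      "\<And>y z. \<lbrakk>y \<in> topspace X; z \<in> topspace X; y \<one> \<noteq> z \<one>\<rbrakk> \<Longrightarrow> \<exists>t\<in>S. d (shift G t y) (shift G t z) > \<kappa>"
    and E: "finite E" "E \<subseteq> carrier G"
      "\<And>y z. \<lbrakk>y \<in> topspace X; z \<in> topspace X; \<forall>e\<in>E. y e = z e\<rbrakk> \<Longrightarrow> d y z < \<eta>"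
    and F: "finite F" "F \<subseteq> carrier G"
    and \<eta>: "\<eta> \<le> \<kappa> / 4" "0 \<le> \<eta>" "\<eta> \<le> \<delta> / 2"
    and W: "W = insert \<one> (E \<union> (\<lambda>(s, e). inv s \<otimes> e) ` ((F \<union> S) \<times> E))"
    and inj: "\<And>C. C \<in> V n \<Longrightarrow> inj_on (\<lambda>f. C #> f) W"
    and few: "real (card (blocked_windows n W)) / real (index n) \<le> \<delta>\<^sup>2 / 8"
  shows "ereal ((real (card (\<D> n)) - real (1 + card S) * real (card (blocked_windows n W))) * ln (real k))
     \<le> log_card (sep_number (\<kappa> / 2) (Map_space X (shift G) d F \<delta> (V n) (act n)) (dist_inf d (V n)))"
proof -
  define \<B> where "\<B> = blocked_windows n W"
  have \<B>: "\<B> \<subseteq> V n" "finite \<B>"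
    unfolding \<B>_def using blocked_windows_subset finite_rcosets finite_subset by blast+
  have Wfin: "finite W" and Wc: "W \<subseteq> carrier G"
    using S(1) E(1) F(1) subsetD[OF S(2)] subsetD[OF E(2)] subsetD[OF F(2)] by (auto simp: W)
  have preimage: "card {C \<in> V n. act n s C \<in> \<B>} \<le> card \<B>" if "s \<in> carrier G" for s
    by (rule card_inj_on_le[of "act n s"])
      (use bij_betw_imp_inj_on[OF bij_coset_action[OF that]] \<B> in \<open>auto intro: inj_on_subset\<close>)
  define P where "P = {C \<in> \<D> n. C \<notin> \<B> \<and> (\<forall>t\<in>S. act n t C \<notin> \<B>)}"
  have PV: "P \<subseteq> V n" using holes_rcosets by (auto simp: P_def)
  have finP: "finite P" using finite_holes by (simp add: P_def)
  have cardP: "card (\<D> n) \<le> card P + (1 + card S) * card \<B>"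
  proof -
    have "\<D> n \<subseteq> P \<union> (\<B> \<union> (\<Union>t\<in>S. {C \<in> V n. act n t C \<in> \<B>}))"
      using holes_rcosets by (auto simp: P_def)
    then have "card (\<D> n) \<le> card (P \<union> (\<B> \<union> (\<Union>t\<in>S. {C \<in> V n. act n t C \<in> \<B>})))"
      using finP \<B> S(1) finite_rcosets by (intro card_mono) auto
    also have "\<dots> \<le> card P + (card \<B> + card (\<Union>t\<in>S. {C \<in> V n. act n t C \<in> \<B>}))"
      by (meson card_Un_le add_left_mono order_trans)
    also have "card (\<Union>t\<in>S. {C \<in> V n. act n t C \<in> \<B>}) \<le> (\<Sum>t\<in>S. card {C \<in> V n. act n t C \<in> \<B>})"
      by (rule card_UN_le[OF S(1)])
    also have "\<dots> \<le> (\<Sum>t\<in>S. card \<B>)" using S(2) by (intro sum_mono preimage) blast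
    finally show ?thesis by simp
  qed
  define \<psi> where "\<psi> p C = (if C \<in> \<D> n then (if C \<in> P then p C else 1) else coset_value C)"
    for p :: "'a set \<Rightarrow> nat" and C
  define ok where "ok p C u \<longleftrightarrow> u \<in> C \<and> (C \<notin> \<B> \<longrightarrow> (\<forall>f\<in>W. x (u \<otimes> f) = \<psi> p (C #> f)))"
    for p C and u :: 'a
  define pick where "pick p C = (SOME u. ok p C u)" for p C
  define \<phi> where "\<phi> p = (\<lambda>C\<in>V n. shift G (inv (pick p C)) x)" for p
  define fillings where "fillings = PiE P (\<lambda>_. {1..k})"
  have pick: "ok p C (pick p C)" if p: "p \<in> fillings" and C: "C \<in> V n" for p C
  proof -
    have q: "(if B \<in> P then p B else 1) \<in> {1..k}" for B
      using p k_pos by (auto simp: fillings_def)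
    have "\<exists>u. ok p C u"
    proof (cases "C \<in> \<B>")
      case True
      then show ?thesis using coset_nonempty[OF C] by (auto simp: ok_def)
    next
      case False
      then have "C \<notin> blocked_windows n W" by (simp add: \<B>_def)
      from window_realized[OF C this Wfin Wc inj[OF C], of "\<lambda>B. if B \<in> P then p B else 1", OF q] show ?thesis
        by (auto simp: ok_def \<psi>_def)
    qed
    then show ?thesis unfolding pick_def by (rule someI_ex)
  qed
  have pick_carrier: "pick p C \<in> carrier G" if "p \<in> fillings" "C \<in> V n" for p C
    using pick[OF that] coset_mem_carrier[OF that(2)] by (auto simp: ok_def)
  have \<phi>X: "\<phi> p C \<in> topspace X" if "p \<in> fillings" "C \<in> V n" for p C
    using pick_carrier[OF that] that(2) orbit_subset by (simp add: \<phi>_def)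
  have \<phi>_window: "\<phi> p C f = \<psi> p (C #> f)"
    if "p \<in> fillings" "C \<in> V n" "C \<notin> \<B>" "f \<in> W" for p C f
  proof -
    have f: "f \<in> carrier G" using that Wc by blast
    have "\<phi> p C f = x (inv (inv (pick p C)) \<otimes> f)"
      unfolding \<phi>_def restrict_apply'[OF that(2)] by (rule shift_apply[OF f])
    also have "\<dots> = x (pick p C \<otimes> f)" using pick_carrier[OF that(1,2)] by simp
    also have "\<dots> = \<psi> p (C #> f)" using pick[OF that(1,2)] that(3,4) by (simp add: ok_def)
    finally show ?thesis .
  qed
  have equivariant: "d (\<phi> p (act n s C)) (shift G s (\<phi> p C)) < \<eta>"
    if p: "p \<in> fillings" and C: "C \<in> V n" and s: "s \<in> F \<union> S" and nB: "C \<notin> \<B>" "act n s C \<notin> \<B>" for p C s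
  proof -
    have sc: "s \<in> carrier G" using s F S by blast
    have sC: "act n s C \<in> V n" using C sc by (rule coset_action_mem)
    have "\<phi> p (act n s C) e = shift G s (\<phi> p C) e" if e: "e \<in> E" for e
    proof -
      have ec: "e \<in> carrier G" using e E by blast
      have "\<phi> p (act n s C) e = \<psi> p (act n s C #> e)"
        using e by (intro \<phi>_window[OF p sC nB(2)]) (simp add: W)
      also have "act n s C #> e = C #> (inv s \<otimes> e)"
        using C sc ec by (simp add: coset_action_eq coset_mult_mult)
      also have "\<psi> p (C #> (inv s \<otimes> e)) = \<phi> p C (inv s \<otimes> e)"
        using e s by (intro \<phi>_window[OF p C nB(1), symmetric]) (auto simp: W)
      also have "\<dots> = shift G s (\<phi> p C) e" by (rule shift_apply[OF ec, symmetric])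
      finally show ?thesis .
    qed
    then show ?thesis using E(3)[OF \<phi>X[OF p sC] shift_closed[OF \<phi>X[OF p C] sc]] by blast
  qed
  have \<delta>0: "\<delta> \<ge> 0" using \<eta> by simp
  have in_Map: "\<phi> p \<in> Map_space X (shift G) d F \<delta> (V n) (act n)" if p: "p \<in> fillings" for p
    unfolding Map_space_def mem_Collect_eq
  proof (intro conjI ballI)
    show "\<phi> p \<in> V n \<rightarrow>\<^sub>E topspace X" using \<phi>X[OF p] by (auto simp: \<phi>_def)
    fix s assume s: "s \<in> F"
    then have sc: "s \<in> carrier G" using F by blast
    let ?B = "\<B> \<union> {C \<in> V n. act n s C \<in> \<B>}"
    show "dist2 d (V n) (\<lambda>v. \<phi> p (act n s v)) (\<lambda>v. shift G s (\<phi> p v)) \<le> \<delta>"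
    proof (rule dist2_le_if_mostly_close[OF finite_rcosets V_nonempty, of ?B, OF _ \<delta>0])
      show "?B \<subseteq> V n" using \<B> by blast
      show "0 \<le> d (\<phi> p (act n s v)) (shift G s (\<phi> p v)) \<and> d (\<phi> p (act n s v)) (shift G s (\<phi> p v)) \<le> 1"
        if v: "v \<in> V n" for v
        using pseudometric(2,3)[OF gen \<phi>X[OF p coset_action_mem[OF v sc]] shift_closed[OF \<phi>X[OF p v] sc]]
        by blast
      show "d (\<phi> p (act n s v)) (shift G s (\<phi> p v)) \<le> \<eta>" if v: "v \<in> V n - ?B" for v
        using equivariant[OF p, of v s] v s by (intro less_imp_le) blast
      have "card ?B \<le> card \<B> + card {C \<in> V n. act n s C \<in> \<B>}" by (rule card_Un_le)
      also have "\<dots> \<le> 2 * card \<B>" using preimage[OF sc] by simp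
      finally have "real (card ?B) \<le> 2 * real (card \<B>)" by linarith
      then have "real (card ?B) / real (card (V n)) \<le> 2 * (real (card \<B>) / real (index n))"
        by (simp add: card_V divide_right_mono)
      also have "\<dots> \<le> \<delta>\<^sup>2 / 4" using few unfolding \<B>_def by linarith
      finally have "real (card ?B) / real (card (V n)) \<le> \<delta>\<^sup>2 / 4" .
      moreover have "\<eta>\<^sup>2 \<le> (\<delta> / 2)\<^sup>2" using \<eta> by (intro power_mono) auto
      then have "\<eta>\<^sup>2 \<le> \<delta>\<^sup>2 / 4" by (simp add: power_divide)
      ultimately show "\<eta>\<^sup>2 + real (card ?B) / real (card (V n)) \<le> \<delta>\<^sup>2"
        using zero_le_power2[of \<delta>] by linarith
    qed
  qed
  have separated: "dist_inf d (V n) (\<phi> p) (\<phi> p') > \<kappa> / 2 \<and> \<phi> p \<noteq> \<phi> p'"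
    if p: "p \<in> fillings" and p': "p' \<in> fillings" and neq: "p \<noteq> p'" for p p'
  proof -
    obtain C where C: "C \<in> P" "p C \<noteq> p' C"
      using PiE_ext[OF p[unfolded fillings_def] p'[unfolded fillings_def]] neq by blast
    have CV: "C \<in> V n" and nB: "C \<notin> \<B>" and CD: "C \<in> \<D> n" using C PV by (auto simp: P_def)
    have letter: "\<phi> r C \<one> = r C" if "r \<in> fillings" for r
      using \<phi>_window[OF that CV nB, of \<one>] C(1) CD rcoset_mult_one[OF CV] by (simp add: W \<psi>_def)
    have neq1: "\<phi> p C \<one> \<noteq> \<phi> p' C \<one>" using C(2) letter p p' by simp
    then obtain t where t: "t \<in> S" "d (shift G t (\<phi> p C)) (shift G t (\<phi> p' C)) > \<kappa>"
      using S(3)[OF \<phi>X[OF p CV] \<phi>X[OF p' CV]] by blast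
    have tc: "t \<in> carrier G" using t S by blast
    have tC: "act n t C \<in> V n" "act n t C \<notin> \<B>"
      using coset_action_mem[OF CV tc] C(1) t(1) by (auto simp: P_def)
    have X: "shift G t (\<phi> p C) \<in> topspace X" "shift G t (\<phi> p' C) \<in> topspace X"
      "\<phi> p (act n t C) \<in> topspace X" "\<phi> p' (act n t C) \<in> topspace X"
      using shift_closed[OF \<phi>X[OF p CV] tc] shift_closed[OF \<phi>X[OF p' CV] tc]
        \<phi>X[OF p tC(1)] \<phi>X[OF p' tC(1)] by blast+
    have "d (\<phi> p (act n t C)) (shift G t (\<phi> p C)) < \<eta>" "d (\<phi> p' (act n t C)) (shift G t (\<phi> p' C)) < \<eta>"
      using equivariant[OF p CV _ nB tC(2)] equivariant[OF p' CV _ nB tC(2)] t(1) by blast+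
    moreover have "d (shift G t (\<phi> p C)) (\<phi> p (act n t C)) = d (\<phi> p (act n t C)) (shift G t (\<phi> p C))"
      by (rule pseudometric(4)[OF gen X(1,3)])
    moreover have "d (shift G t (\<phi> p C)) (shift G t (\<phi> p' C))
        \<le> d (shift G t (\<phi> p C)) (\<phi> p (act n t C)) + d (\<phi> p (act n t C)) (shift G t (\<phi> p' C))"
      by (rule pseudometric_triangle[OF gen X(1,3,2)])
    moreover have "d (\<phi> p (act n t C)) (shift G t (\<phi> p' C))
        \<le> d (\<phi> p (act n t C)) (\<phi> p' (act n t C)) + d (\<phi> p' (act n t C)) (shift G t (\<phi> p' C))"
      by (rule pseudometric_triangle[OF gen X(3,4,2)])
    ultimately have "\<kappa> / 2 < d (\<phi> p (act n t C)) (\<phi> p' (act n t C))"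
      using t(2) \<eta>(1) by linarith
    also have "\<dots> \<le> dist_inf d (V n) (\<phi> p) (\<phi> p')"
      unfolding dist_inf_def using finite_rcosets tC(1) by (intro Max_ge) auto
    finally show ?thesis using neq1 by auto
  qed
  have inj\<phi>: "inj_on \<phi> fillings"
    using separated by (intro inj_onI) blast
  have finfill: "finite fillings" using finP by (simp add: fillings_def finite_PiE)
  have "card (\<phi> ` fillings) = k ^ card P"
    using card_image[OF inj\<phi>] finP by (simp add: fillings_def card_PiE)
  then have "ln (real (card (\<phi> ` fillings))) = real (card P) * ln (real k)"
    using k_pos by (simp add: ln_realpow)
  moreover have "real (card (\<D> n)) \<le> real (card P) + real (1 + card S) * real (card \<B>)"
    using cardP by (metis of_nat_add of_nat_le_iff of_nat_mult)
  then have "(real (card (\<D> n)) - real (1 + card S) * real (card \<B>)) * ln (real k)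
      \<le> real (card P) * ln (real k)"
    using k_pos by (intro mult_right_mono) auto
  ultimately have "ereal ((real (card (\<D> n)) - real (1 + card S) * real (card \<B>)) * ln (real k))
      \<le> ereal (ln (real (card (\<phi> ` fillings))))" by simp
  also have "\<dots> \<le> log_card (sep_number (\<kappa> / 2) (Map_space X (shift G) d F \<delta> (V n) (act n)) (dist_inf d (V n)))"
  proof (rule log_card_sep_number_ge)
    show "\<phi> ` fillings \<subseteq> Map_space X (shift G) d F \<delta> (V n) (act n)" using in_Map by blast
    show "separated_set (\<kappa> / 2) (dist_inf d (V n)) (\<phi> ` fillings)"
      unfolding separated_set_def using finfill separated by blast
    show "\<phi> ` fillings \<noteq> {}" using k_pos by (simp add: fillings_def PiE_eq_empty_iff)
  qed
  finally show ?thesis by (simp add: \<B>_def)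
qed

theorem entropy_lower_bound:
  "ereal (\<theta> * ln (real k)) \<le> sofic_entropy_wrt G V act X (shift G) d"
proof -
  have lnk: "ln (real k) \<ge> 0" using k_pos by simp
  obtain S \<kappa> where S: "finite S" "S \<subseteq> carrier G" and \<kappa>: "\<kappa> > 0"
    and sep: "\<And>y z. \<lbrakk>y \<in> topspace X; z \<in> topspace X; y \<one> \<noteq> z \<one>\<rbrakk> \<Longrightarrow>
       \<exists>t\<in>S. d (shift G t y) (shift G t z) > \<kappa>"
    using separated_if_differ[OF gen] by blast
  have "ereal (\<theta> * ln (real k)) \<le> limsup (\<lambda>n. ereal (1 / real (card (V n))) * log_card
      (sep_number (\<kappa> / 2) (Map_space X (shift G) d F \<delta> (V n) (act n)) (dist_inf d (V n))))"
    if F: "F \<subseteq> carrier G" "finite F" and \<delta>: "\<delta> > 0" for F \<delta>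
  proof -
    define \<eta> where "\<eta> = min (\<kappa> / 4) (\<delta> / 2)"
    have \<eta>: "\<eta> > 0" "\<eta> \<le> \<kappa> / 4" "0 \<le> \<eta>" "\<eta> \<le> \<delta> / 2" using \<kappa> \<delta> by (auto simp: \<eta>_def)
    obtain E where E: "finite E" "E \<subseteq> carrier G"
      and agree: "\<And>y z. \<lbrakk>y \<in> topspace X; z \<in> topspace X; \<forall>e\<in>E. y e = z e\<rbrakk> \<Longrightarrow> d y z < \<eta>"
      using close_if_agree[OF gen \<eta>(1)] by blast
    define W where "W = insert \<one> (E \<union> (\<lambda>(s, e). inv s \<otimes> e) ` ((F \<union> S) \<times> E))"
    have W: "finite W" "W \<subseteq> carrier G" 
      using S(1) E(1) F(2) subsetD[OF S(2)] subsetD[OF E(2)] subsetD[OF F(1)] by (auto simp: W_def)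
    define gap where "gap n = real (card W) * (real (card (\<D> n)) / real (index n) - \<theta>)" for n
    have gap: "gap \<longlonglongrightarrow> 0"
    proof -
      have "gap \<longlonglongrightarrow> real (card W) * (\<theta> - \<theta>)"
        unfolding gap_def by (intro tendsto_intros hole_density)
      then show ?thesis by simp
    qed
    have blocked_le: "real (card (blocked_windows n W)) / real (index n) \<le> gap n" for n
      using card_blocked_windows[OF W, of n] index_pos[of n] by (simp add: gap_def field_simps)
    define r where "r n = (real (card (\<D> n)) / real (index n) - real (1 + card S) * gap n) * ln (real k)" for n
    have "(\<lambda>n. ereal (r n)) \<longlonglongrightarrow> ereal ((\<theta> - real (1 + card S) * 0) * ln (real k))"
      unfolding r_def by (intro tendsto_ereal tendsto_mult tendsto_diff hole_density gap tendsto_const)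
    from lim_imp_Limsup[OF trivial_limit_sequentially this]
    have "ereal (\<theta> * ln (real k)) = limsup (\<lambda>n. ereal (r n))" by simp
    also have "\<dots> \<le> limsup (\<lambda>n. ereal (1 / real (card (V n))) * log_card
      (sep_number (\<kappa> / 2) (Map_space X (shift G) d F \<delta> (V n) (act n)) (dist_inf d (V n))))"
    proof (rule Limsup_mono)
      have "\<forall>\<^sub>F n in sequentially. gap n < \<delta>\<^sup>2 / 8"
        using gap \<delta> by (intro order_tendstoD(2)) auto
      with eventually_window_inj[OF W]
      show "\<forall>\<^sub>F n in sequentially. ereal (r n) \<le> ereal (1 / real (card (V n))) * log_card
        (sep_number (\<kappa> / 2) (Map_space X (shift G) d F \<delta> (V n) (act n)) (dist_inf d (V n)))"
      proof eventually_elim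
        case (elim n)
        let ?b = "real (card (blocked_windows n W))"
        have N: "real (index n) > 0" using index_pos by simp
        have few: "?b / real (index n) \<le> \<delta>\<^sup>2 / 8" using blocked_le[of n] elim by linarith
        have "r n \<le> (1 / real (index n)) * ((real (card (\<D> n)) - real (1 + card S) * ?b) * ln (real k))"
        proof -
          have "real (1 + card S) * (?b / real (index n)) \<le> real (1 + card S) * gap n"
            by (intro mult_left_mono blocked_le) simp
          then have "r n \<le> (real (card (\<D> n)) / real (index n) - real (1 + card S) * (?b / real (index n))) * ln (real k)"
            unfolding r_def using lnk by (intro mult_right_mono) auto
          also have "\<dots> = (1 / real (index n)) * ((real (card (\<D> n)) - real (1 + card S) * ?b) * ln (real k))"
            using N by (simp add: field_simps)
          finally show ?thesis .
        qed
        then have "ereal (r n) \<le> ereal (1 / real (index n)) *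
            ereal ((real (card (\<D> n)) - real (1 + card S) * ?b) * ln (real k))" by simp
        also have "\<dots> \<le> ereal (1 / real (index n)) * log_card
            (sep_number (\<kappa> / 2) (Map_space X (shift G) d F \<delta> (V n) (act n)) (dist_inf d (V n)))"
          using elim(1)
          by (intro ereal_mult_left_mono many_separated_models[OF S sep E agree F(2,1) \<eta>(2-4) W_def _ few]) auto
        finally show ?case by (simp add: card_V)
      qed
    qed
    finally show ?thesis .
  qed
  then have "ereal (\<theta> * ln (real k)) \<le> (INF F \<in> {F. F \<subseteq> carrier G \<and> finite F}. INF \<delta> \<in> {0<..}.
      limsup (\<lambda>n. ereal (1 / real (card (V n))) * log_card
        (sep_number (\<kappa> / 2) (Map_space X (shift G) d F \<delta> (V n) (act n)) (dist_inf d (V n)))))"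
    by (intro INF_greatest) auto
  then show ?thesis
    unfolding sofic_entropy_wrt_def using \<kappa> by (intro SUP_upper2[of "\<kappa> / 2"]) auto
qed

end

theorem sofic_entropy_eq:
  "sofic_entropy G V act X (shift G) = ereal (\<theta> * ln (real k))"
  unfolding sofic_entropy_def
proof (rule the_equality)
  show "\<forall>d. generating_pseudometric G X (shift G) d \<longrightarrow>
      sofic_entropy_wrt G V act X (shift G) d = ereal (\<theta> * ln (real k))"
  proof (intro allI impI)
    fix d assume gen: "generating_pseudometric G X (shift G) d"
    show "sofic_entropy_wrt G V act X (shift G) d = ereal (\<theta> * ln (real k))"
      by (rule order.antisym[OF entropy_upper_bound[OF gen] entropy_lower_bound[OF gen]])
  qed
next
  fix h assume h: "\<forall>d. generating_pseudometric G X (shift G) d \<longrightarrow>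
      sofic_entropy_wrt G V act X (shift G) d = h"
  note gen = generating_pseudometric_exists
  have "h = sofic_entropy_wrt G V act X (shift G) (\<lambda>y z. if y \<one> = z \<one> then 0 else 1)"
    by (rule h[rule_format, OF gen, symmetric])
  also have "\<dots> = ereal (\<theta> * ln (real k))"
    by (rule order.antisym[OF entropy_upper_bound[OF gen] entropy_lower_bound[OF gen]])
  finally show "h = ereal (\<theta> * ln (real k))" .
qed

end

section \<open>Existence of Toeplitz elements with prescribed entropy\<close>

lemma (in residual_chain) ratio_eq_relative_index:
  "ratio n (Suc n) = subgroup_index (G\<lparr>carrier := K n\<rparr>) (K (Suc n))"
proof -
  have "subcosets (Suc n) (K n) = rcosets\<^bsub>G\<lparr>carrier := K n\<rparr>\<^esub> (K (Suc n))"
  proof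
    show "subcosets (Suc n) (K n) \<subseteq> rcosets\<^bsub>G\<lparr>carrier := K n\<rparr>\<^esub> (K (Suc n))"
    proof
      fix C assume C: "C \<in> subcosets (Suc n) (K n)"
      then have CV: "C \<in> rcosets (K (Suc n))" by (simp add: subcosets_def)
      obtain u where u: "u \<in> C" using coset_nonempty[OF CV] ..
      then have "u \<in> K n" "C = K (Suc n) #> u"
        using C coset_rep[OF CV] by (auto simp: subcosets_def)
      then show "C \<in> rcosets\<^bsub>G\<lparr>carrier := K n\<rparr>\<^esub> (K (Suc n))" by (auto simp: RCOSETS_def)
    qed
    show "rcosets\<^bsub>G\<lparr>carrier := K n\<rparr>\<^esub> (K (Suc n)) \<subseteq> subcosets (Suc n) (K n)"
    proof
      fix C assume "C \<in> rcosets\<^bsub>G\<lparr>carrier := K n\<rparr>\<^esub> (K (Suc n))"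
      then obtain u where u: "u \<in> K n" "C = K (Suc n) #> u" by (auto simp: RCOSETS_def)
      then show "C \<in> subcosets (Suc n) (K n)"
        using coset_refine[OF _ K_coset, of n "Suc n" u] by simp
    qed
  qed
  then show ?thesis by (simp add: subgroup_index_def)
qed

lemma (in residual_chain) coset_actions_sofic:
  assumes s: "s \<in> carrier G" and t: "t \<in> carrier G"
  shows "(\<lambda>n. real (card {C \<in> rcosets (K n). coset_action G (K n) (s \<otimes> t) C
      = coset_action G (K n) s (coset_action G (K n) t C)}) / real (card (rcosets (K n)))) \<longlonglongrightarrow> 1"
    and "s \<noteq> t \<Longrightarrow> (\<lambda>n. real (card {C \<in> rcosets (K n). coset_action G (K n) s C
      \<noteq> coset_action G (K n) t C}) / real (card (rcosets (K n)))) \<longlonglongrightarrow> 1"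
proof -
  have pos: "card (rcosets (K n)) \<noteq> 0" for n using index_pos[of n] by (simp add: subgroup_index_def)
  have quotient: "real (card (rcosets (K n))) / real (card (rcosets (K n))) = 1" for n
    by (rule divide_self) (simp only: of_nat_eq_0_iff pos not_False_eq_True)
  have "{C \<in> rcosets (K n). coset_action G (K n) (s \<otimes> t) C
      = coset_action G (K n) s (coset_action G (K n) t C)} = rcosets (K n)" for n
    using coset_action_mult[OF _ s t] by blast
  then show "(\<lambda>n. real (card {C \<in> rcosets (K n). coset_action G (K n) (s \<otimes> t) C
      = coset_action G (K n) s (coset_action G (K n) t C)}) / real (card (rcosets (K n)))) \<longlonglongrightarrow> 1"
    by (simp only: quotient tendsto_const)
  assume neq: "s \<noteq> t"
  from eventually_coset_action_neq[OF s t neq]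
  have "\<forall>\<^sub>F n in sequentially. real (card {C \<in> rcosets (K n). coset_action G (K n) s C
      \<noteq> coset_action G (K n) t C}) / real (card (rcosets (K n))) = 1"
  proof eventually_elim
    case (elim n)
    then have "{C \<in> rcosets (K n). coset_action G (K n) s C \<noteq> coset_action G (K n) t C} = rcosets (K n)"
      by blast
    then show ?case by (simp only: quotient)
  qed
  then show "(\<lambda>n. real (card {C \<in> rcosets (K n). coset_action G (K n) s C
      \<noteq> coset_action G (K n) t C}) / real (card (rcosets (K n)))) \<longlonglongrightarrow> 1"
    by (rule tendsto_eventually)
qed

lemma sofic_entropy_Suc:
  "sofic_entropy G V \<sigma> X act = sofic_entropy G (\<lambda>n. V (Suc n)) (\<lambda>n. \<sigma> (Suc n)) X act"
proof -
  have shift: "limsup f = limsup (\<lambda>n. f (Suc n))" for f :: "nat \<Rightarrow> ereal"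
    using limsup_shift[of f] by simp
  have "sofic_entropy_wrt G V \<sigma> X act d = sofic_entropy_wrt G (\<lambda>n. V (Suc n)) (\<lambda>n. \<sigma> (Suc n)) X act d" for d
    unfolding sofic_entropy_wrt_def by (intro SUP_cong INF_cong refl shift)
  then show ?thesis by (simp add: sofic_entropy_def)
qed

theorem theorem7p4:
  fixes G :: "('g, 'b) monoid_scheme" (structure)
    and H :: "nat \<Rightarrow> 'g set"
    and a :: "nat \<Rightarrow> nat"
    and \<theta> :: real
    and k :: nat
  assumes "group G"
    and "countable (carrier G)"
    and "\<And>n. n \<ge> 1 \<Longrightarrow> H n \<lhd> G"
    and "\<And>n. n \<ge> 1 \<Longrightarrow> finite (rcosets (H n))"
    and "\<And>n. n \<ge> 1 \<Longrightarrow> H (Suc n) \<subseteq> H n"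
    and "\<And>n. n \<ge> 1 \<Longrightarrow> H (Suc n) \<noteq> H n"
    and "(\<Inter>n\<in>{1..}. H n) = {\<one>}"
    and "\<And>n. n \<ge> 1 \<Longrightarrow> a n > 0"
    and "a 1 \<le> subgroup_index G (H 1)"
    and "\<And>n. n \<ge> 2 \<Longrightarrow> a n < a (n - 1) * subgroup_index (G\<lparr>carrier := H (n - 1)\<rparr>) (H n)"
    and "(\<lambda>n. real (a n) / real (subgroup_index G (H n))) \<longlonglongrightarrow> \<theta>"
    and "\<theta> < 1"
    and "k > 1"
  shows "sofic_approximation G (\<lambda>n. rcosets (H n)) (\<lambda>n. coset_action G (H n)) \<and>
    (\<exists>x \<in> topspace (full_shift G k).
       toeplitz G H x \<and>
       (\<forall>n\<ge>1. num_holes G (H n) x = a n) \<and>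
       sofic_entropy G (\<lambda>n. rcosets (H n)) (\<lambda>n. coset_action G (H n))
         (orbit_closure G k x) (shift G) = ereal (\<theta> * ln (real k)) \<and>
       (\<lambda>n. real (num_holes G (H n) x) / real (subgroup_index G (H n))) \<longlonglongrightarrow> \<theta>)"
proof -
  \<comment> \<open>The chain is reindexed to start at \<open>0\<close>. A shift of the index changes neither limits nor the entropy.\<close>
  define K where "K n = H (Suc n)" for n
  define b where "b n = a (Suc n)" for n
  have Inter_K: "(\<Inter>n. K n) = {\<one>}"
  proof -
    have "(\<Inter>n\<in>{1..}. H n) = (\<Inter>n. H (Suc n))"
      by (auto simp: Suc_le_eq gr0_conv_Suc)
    then show ?thesis using assms(7) by (simp add: K_def)
  qed
  interpret group G by fact
  interpret residual_chain G K
    by (intro residual_chain.intro residual_chain_axioms.intro is_group assms(2) Inter_K)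
      (simp_all add: K_def assms(3-6) psubset_eq)
  have b0: "b 0 \<le> index 0" using assms(9) by (simp add: b_def K_def)
  have b_Suc: "b (Suc n) < b n * ratio n (Suc n)" for n
    unfolding ratio_eq_relative_index using assms(10)[of "Suc (Suc n)"] by (simp add: b_def K_def)
  obtain \<D> where \<D>: "hole_system G K \<D>" and card_\<D>: "\<And>n. card (\<D> n) = b n"
    using hole_system_exists[OF b0 b_Suc] by blast
  interpret hole_system G K \<D> by (rule \<D>)
  have "k \<ge> 2" using assms(13) by simp
  from toeplitz_filling_exists[OF this] obtain x where x: "x \<in> carrier G \<rightarrow>\<^sub>E {1..k}"
    and const: "\<And>n C. C \<in> rcosets (K n) \<Longrightarrow> x constant_on C \<longleftrightarrow> C \<notin> \<D> n"
    and realized: "\<And>n ps. (n, ps) \<in> requests k \<Longrightarrow> \<exists>h\<in>K n. \<forall>(u, v)\<in>set ps. x (h \<otimes> u) = v"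
    by blast
  have density: "(\<lambda>n. real (card (\<D> n)) / real (index n)) \<longlonglongrightarrow> \<theta>"
    using LIMSEQ_Suc[OF assms(11)] by (simp add: card_\<D> b_def K_def)
  interpret toeplitz_array G K \<D> k x \<theta>
  proof (intro toeplitz_array.intro toeplitz_array_axioms.intro \<D> density realized)
    show "orbit_system G k x"
      by (intro orbit_system.intro orbit_system_axioms.intro is_group x)
    show "1 \<le> k" using assms(13) by simp
  qed (use const in auto)
  have sofic: "sofic_approximation G (\<lambda>n. rcosets (H n)) (\<lambda>n. coset_action G (H n))"
    unfolding sofic_approximation_def
  proof (intro conjI allI ballI impI)
    fix n :: nat assume n: "1 \<le> n"
    then show "finite (rcosets (H n))" by (rule assms(4))
    obtain m where "n = Suc m" using n by (cases n) auto
    then show "coset_action G (H n) \<in> carrier G \<rightarrow> Bij (rcosets (H n))"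
      using coset_action_Bij[of _ m] by (simp add: K_def)
  next
    fix s t assume s: "s \<in> carrier G" and t: "t \<in> carrier G"
    show "(\<lambda>n. real (card {v \<in> rcosets (H n). coset_action G (H n) (s \<otimes> t) v
        = coset_action G (H n) s (coset_action G (H n) t v)}) / real (card (rcosets (H n)))) \<longlonglongrightarrow> 1"
      by (rule LIMSEQ_imp_Suc) (rule coset_actions_sofic(1)[OF s t, unfolded K_def])
    assume neq: "s \<noteq> t"
    show "(\<lambda>n. real (card {v \<in> rcosets (H n). coset_action G (H n) s v
        \<noteq> coset_action G (H n) t v}) / real (card (rcosets (H n)))) \<longlonglongrightarrow> 1"
      by (rule LIMSEQ_imp_Suc) (rule coset_actions_sofic(2)[OF s t neq, unfolded K_def])
  qed
  have holes: "num_holes G (H n) x = a n" if n: "n \<ge> 1" for n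
  proof -
    obtain m where m: "n = Suc m" using n by (cases n) auto
    have "{C \<in> rcosets (K m). \<not> x constant_on C} = \<D> m"
      using const[of _ m] holes_rcosets[of m] by blast
    then have "num_holes G (K m) x = b m" by (simp add: num_holes_def card_\<D>)
    then show ?thesis by (simp add: K_def b_def m)
  qed
  have "g \<in> (\<Union>n\<in>{1..}. Per G (H n) x)" if g: "g \<in> carrier G" for g
  proof -
    obtain m where m: "g \<notin> D m" using holes_vanish by blast
    then have C: "K m #> g \<notin> \<D> m" unfolding mem_D_iff[OF g] .
    have "x (inv h \<otimes> g) = x g" if h: "h \<in> K m" for h
    proof -
      have "inv h \<in> K m" using h subgroup.m_inv_closed[OF subgroup_K] by blast
      then have "inv h \<otimes> g \<in> K m #> g" using g by (rule coset_left_mult)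
      then show ?thesis
        using coset_value[OF cosetI[OF g] C] coset_self[OF g, of m] by metis
    qed
    then have "g \<in> Per G (H (Suc m)) x" using g by (simp add: Per_def K_def)
    then show ?thesis by (intro UN_I[of "Suc m"]) auto
  qed
  then have "toeplitz G H x"
    unfolding toeplitz_def by (auto simp: Per_def)
  moreover have "sofic_entropy G (\<lambda>n. rcosets (H n)) (\<lambda>n. coset_action G (H n))
      (orbit_closure G k x) (shift G) = ereal (\<theta> * ln (real k))"
    unfolding sofic_entropy_Suc[of G "\<lambda>n. rcosets (H n)"]
    using sofic_entropy_eq unfolding K_def .
  moreover have "(\<lambda>n. real (num_holes G (H n) x) / real (subgroup_index G (H n))) \<longlonglongrightarrow> \<theta>"
    by (rule LIMSEQ_imp_Suc) (use LIMSEQ_Suc[OF assms(11)] in \<open>simp add: holes\<close>)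
  ultimately show ?thesis
    using sofic holes x by (intro conjI bexI[of _ x]) simp_all
qed

end
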